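(* If $P$ and $Q$ are finite partially ordered sets, then there is a homeomorphism $$|\mathcal{S}(P)\times\mathcal{S}(Q)|\cong|\mathcal{S}(P)|\times|\mathcal{S}(Q)|.$$
   Context: For $n\ge 0$, $[n]=\{0<1<\cdots<n\}$, and $\Delta$ is the category with objects $[n]$, $n\ge0$, and order preserving (weakly monotone) maps as morphisms. Simplicial sets are contravariant functors $\Delta\to\mathtt{Set}$; the product of simplicial sets is $(C\times D)([n])=C([n])\times D([n])$. $\Delta_n$ is the simplicial set represented by $[n]$. For a finite partially ordered set $P$, $\mathcal{S}(P)$ is the simplicial set with $\mathcal{S}(P)([n])$ the set of order preserving maps $[n]\to P$. The topological standard $n$-simplex is $|\Delta_n|=\{(x_0,\ldots,x_n)\in\mathbb{R}^{n+1}: x_i\ge 0,\ \sum x_i=1\}$ with the subspace topology; $\theta:[n]\to[m]$ induces $\theta_*:|\Delta_n|\to|\Delta_m|$, $\theta_*(t_0,\ldots,t_n)=(s_0,\ldots,s_m)$ with $s_i=\sum_{j\in\theta^{-1}(i)}t_j$. The geometric realization of a simplicial set $C$ is the colimit in topological spaces $|C|=\varinjlim_{\Delta_n\to C}|\Delta_n|$ over the category $\Delta\downarrow C$ whose objects are maps of simplicial sets $\Delta_n\to C$ and whose morphisms are commuting triangles over $C$. The product of realizations carries the product topology. *)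

theory Defs
  imports "HOL-Analysis.Analysis" "HOL-Homology.Simplices"
begin

section \<open>The category of finite ordinals and simplicial sets\<close>

text \<open>
  The ordinal $[k]$ is \<open>{..k}\<close>.  Here and below, functions are taken to be extensional (with value
  \<^const>\<open>undefined\<close> off their domain), so that equality of HOL functions is equality of maps.
\<close>

definition ord_maps :: "nat \<Rightarrow> nat \<Rightarrow> (nat \<Rightarrow> nat) set" where
  "ord_maps k l = {\<theta> \<in> {..k} \<rightarrow>\<^sub>E {..l}. mono_on {..k} \<theta>}"

abbreviation ord_id :: "nat \<Rightarrow> nat \<Rightarrow> nat" where
  "ord_id k \<equiv> restrict id {..k}"

text \<open>
  A contravariant functor from ordinals to sets: \<open>simp_of C k\<close> is $C([k])$, and for
  \<open>\<theta> \<in> ord_maps k l\<close> the induced map $C([l]) \to C([k])$ is \<open>act_of C k l \<theta>\<close>.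
\<close>

record 'a sset =
  simp_of :: "nat \<Rightarrow> 'a set"
  act_of :: "nat \<Rightarrow> nat \<Rightarrow> (nat \<Rightarrow> nat) \<Rightarrow> 'a \<Rightarrow> 'a"

definition simplicial_set :: "'a sset \<Rightarrow> bool" where
  "simplicial_set C \<longleftrightarrow>
     (\<forall>k l. \<forall>\<theta>\<in>ord_maps k l. act_of C k l \<theta> \<in> simp_of C l \<rightarrow> simp_of C k) \<and>
     (\<forall>k. \<forall>x\<in>simp_of C k. act_of C k k (ord_id k) x = x) \<and>
     (\<forall>k l m. \<forall>\<theta>\<in>ord_maps k l. \<forall>\<eta>\<in>ord_maps l m. \<forall>x\<in>simp_of C m.
        act_of C k m (compose {..k} \<eta> \<theta>) x = act_of C k l \<theta> (act_of C l m \<eta> x))"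

definition sset_hom :: "'a sset \<Rightarrow> 'b sset \<Rightarrow> (nat \<Rightarrow> 'a \<Rightarrow> 'b) set" where
  "sset_hom C D =
     {\<sigma>. (\<forall>k. \<sigma> k \<in> simp_of C k \<rightarrow>\<^sub>E simp_of D k) \<and>
         (\<forall>k l. \<forall>\<theta>\<in>ord_maps k l. \<forall>x\<in>simp_of C l.
            \<sigma> k (act_of C k l \<theta> x) = act_of D k l \<theta> (\<sigma> l x))}"

definition sset_comp :: "'a sset \<Rightarrow> (nat \<Rightarrow> 'b \<Rightarrow> 'c) \<Rightarrow> (nat \<Rightarrow> 'a \<Rightarrow> 'b) \<Rightarrow> (nat \<Rightarrow> 'a \<Rightarrow> 'c)" where
  "sset_comp C \<tau> \<sigma> = (\<lambda>k. compose (simp_of C k) (\<tau> k) (\<sigma> k))"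

definition sset_prod :: "'a sset \<Rightarrow> 'b sset \<Rightarrow> ('a \<times> 'b) sset" where
  "sset_prod C D =
     \<lparr>simp_of = (\<lambda>k. simp_of C k \<times> simp_of D k),
      act_of = (\<lambda>k l \<theta>. map_prod (act_of C k l \<theta>) (act_of D k l \<theta>))\<rparr>"

definition representable :: "nat \<Rightarrow> (nat \<Rightarrow> nat) sset" where
  "representable n =
     \<lparr>simp_of = (\<lambda>k. ord_maps k n), act_of = (\<lambda>k l \<theta> f. compose {..k} f \<theta>)\<rparr>"

definition poset_sset :: "'p set \<Rightarrow> 'p rel \<Rightarrow> (nat \<Rightarrow> 'p) sset" where
  "poset_sset P r =
     \<lparr>simp_of = (\<lambda>k. {f \<in> {..k} \<rightarrow>\<^sub>E P. monotone_on {..k} (\<le>) (\<lambda>x y. (x, y) \<in> r) f}),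
      act_of = (\<lambda>k l \<theta> f. compose {..k} f \<theta>)\<rparr>"

lemma ord_id_in_ord_maps: "ord_id k \<in> ord_maps k k"
  by (auto simp: ord_maps_def monotone_on_def)

lemma compose_in_ord_maps:
  assumes "\<theta> \<in> ord_maps k l" "\<eta> \<in> ord_maps l m"
  shows "compose {..k} \<eta> \<theta> \<in> ord_maps k m"
proof -
  have "\<theta> x \<in> {..l}" if "x \<in> {..k}" for x
    using assms(1) that by (auto simp: ord_maps_def PiE_iff)
  then show ?thesis
    using assms by (auto simp: ord_maps_def PiE_iff monotone_on_def compose_def)
qed

lemma simplicial_set_poset_sset: "simplicial_set (poset_sset P r)"
proof -
  have ran: "\<theta> x \<le> l" if "\<theta> \<in> ord_maps k l" "x \<le> k" for \<theta> k l x
    using that by (auto simp: ord_maps_def PiE_iff)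
  have mon: "\<theta> x \<le> \<theta> y" if "\<theta> \<in> ord_maps k l" "x \<le> y" "y \<le> k" for \<theta> k l x y
    using that by (auto simp: ord_maps_def monotone_on_def)
  show ?thesis
    unfolding simplicial_set_def poset_sset_def
    by (auto simp: PiE_iff monotone_on_def compose_def ran mon fun_eq_iff extensional_def)
qed

lemma representable_eq_poset_sset:
  "representable n = poset_sset {..n} {(i, j). i \<le> j \<and> j \<le> n}"
  by (auto simp: representable_def poset_sset_def ord_maps_def monotone_on_def PiE_iff)

lemma simplicial_set_representable: "simplicial_set (representable n)"
  by (simp add: representable_eq_poset_sset simplicial_set_poset_sset)

lemma simplicial_set_sset_prod:
  assumes "simplicial_set C" "simplicial_set D"
  shows "simplicial_set (sset_prod C D)"
  using assms unfolding simplicial_set_def sset_prod_def by (fastforce simp: Pi_iff)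


section \<open>Colimits of topological spaces\<close>

text \<open>The quotient topology on the set of classes of \<open>R\<close>, an equivalence relation.\<close>

definition quotient_topology :: "'a topology \<Rightarrow> 'a rel \<Rightarrow> 'a set topology" where
  "quotient_topology X R =
     topology (\<lambda>U. U \<subseteq> topspace X // R \<and> openin X {x \<in> topspace X. R `` {x} \<in> U})"

text \<open>
  A diagram of spaces is given by an index set \<open>I\<close>, spaces \<open>F i\<close>, and a set \<open>M\<close> of arrows
  \<open>(i, f, j)\<close> with \<open>f\<close> the map from \<open>F i\<close> to \<open>F j\<close> induced by the arrow.  The colimit is the
  quotient of the disjoint union of the \<open>F i\<close> by the equivalence relation generated by identifying
  \<open>(i, x)\<close> with \<open>(j, f x)\<close>; it is characterised by the universal property proved below.
\<close>

definition glue ::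
  "('i \<Rightarrow> 'x topology) \<Rightarrow> ('i \<times> ('x \<Rightarrow> 'x) \<times> 'i) set \<Rightarrow> ('i \<times> 'x) \<Rightarrow> ('i \<times> 'x) \<Rightarrow> bool" where
  "glue F M p q \<longleftrightarrow>
     (\<exists>i f j x. (i, f, j) \<in> M \<and> x \<in> topspace (F i) \<and> p = (i, x) \<and> q = (j, f x))"

definition colimit_rel ::
  "('i \<Rightarrow> 'x topology) \<Rightarrow> ('i \<times> ('x \<Rightarrow> 'x) \<times> 'i) set \<Rightarrow> ('i \<times> 'x) rel" where
  "colimit_rel F M = {(p, q). equivclp (glue F M) p q}"

definition colimit_topology ::
  "'i set \<Rightarrow> ('i \<Rightarrow> 'x topology) \<Rightarrow> ('i \<times> ('x \<Rightarrow> 'x) \<times> 'i) set \<Rightarrow> ('i \<times> 'x) set topology" where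
  "colimit_topology I F M = quotient_topology (sum_topology F I) (colimit_rel F M)"

definition colimit_inj ::
  "('i \<Rightarrow> 'x topology) \<Rightarrow> ('i \<times> ('x \<Rightarrow> 'x) \<times> 'i) set \<Rightarrow> 'i \<Rightarrow> 'x \<Rightarrow> ('i \<times> 'x) set" where
  "colimit_inj F M i x = colimit_rel F M `` {(i, x)}"

lemma openin_quotient_topology:
  "openin (quotient_topology X R) U \<longleftrightarrow>
     U \<subseteq> topspace X // R \<and> openin X {x \<in> topspace X. R `` {x} \<in> U}"
proof -
  have "istopology (\<lambda>U. U \<subseteq> topspace X // R \<and> openin X {x \<in> topspace X. R `` {x} \<in> U})"
    unfolding istopology_def
  proof (intro conjI allI impI, goal_cases)
    case (2 S T)
    have "{x \<in> topspace X. R `` {x} \<in> S \<inter> T} =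
          {x \<in> topspace X. R `` {x} \<in> S} \<inter> {x \<in> topspace X. R `` {x} \<in> T}" by auto
    then show ?case using 2 by auto
  next
    case (4 K)
    have "{x \<in> topspace X. R `` {x} \<in> \<Union>K} = (\<Union>S\<in>K. {x \<in> topspace X. R `` {x} \<in> S})" by auto
    then show ?case using 4 by auto
  qed auto
  then show ?thesis by (simp add: quotient_topology_def topology_inverse')
qed

lemma topspace_quotient_topology: "topspace (quotient_topology X R) = topspace X // R"
proof -
  have "{x \<in> topspace X. R `` {x} \<in> topspace X // R} = topspace X"
    by (auto simp: quotient_def)
  then have "openin (quotient_topology X R) (topspace X // R)"
    by (simp add: openin_quotient_topology)
  then show ?thesis
    by (meson openin_quotient_topology openin_subset openin_topspace subset_antisym)
qed

lemma quotient_map_quotient_topology: "quotient_map X (quotient_topology X R) (\<lambda>x. R `` {x})"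
  by (auto simp: quotient_map_def topspace_quotient_topology openin_quotient_topology quotient_def)

lemma quotient_map_colimit_topology:
  "quotient_map (sum_topology F I) (colimit_topology I F M) (\<lambda>(i, x). colimit_inj F M i x)"
  using quotient_map_quotient_topology[of "sum_topology F I" "colimit_rel F M"]
  by (simp add: colimit_topology_def colimit_inj_def case_prod_unfold)

lemma continuous_map_colimit_inj:
  assumes "i \<in> I"
  shows "continuous_map (F i) (colimit_topology I F M) (colimit_inj F M i)"
proof -
  have "continuous_map (F i) (sum_topology F I) (\<lambda>x. (i, x))"
    using assms by (simp add: continuous_map_component_injection)
  from continuous_map_compose[OF this quotient_imp_continuous_map[OF quotient_map_colimit_topology]]
  show ?thesis by (simp add: o_def)
qed

lemma colimit_inj_cocone:
  assumes "(i, f, j) \<in> M" "x \<in> topspace (F i)"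
  shows "colimit_inj F M j (f x) = colimit_inj F M i x"
proof -
  have "equivclp (glue F M) (i, x) (j, f x)"
    using assms by (auto simp: glue_def intro!: r_into_equivclp)
  then show ?thesis
    unfolding colimit_inj_def colimit_rel_def
    by (auto intro: equivclp_trans equivclp_sym)
qed

theorem colimit_universal:
  assumes cont: "\<And>i. i \<in> I \<Longrightarrow> continuous_map (F i) Y (g i)"
    and cocone: "\<And>i f j x. (i, f, j) \<in> M \<Longrightarrow> x \<in> topspace (F i) \<Longrightarrow> g j (f x) = g i x"
  shows "\<exists>!h. h \<in> extensional (topspace (colimit_topology I F M)) \<and>
              continuous_map (colimit_topology I F M) Y h \<and>
              (\<forall>i\<in>I. \<forall>x\<in>topspace (F i). h (colimit_inj F M i x) = g i x)"
proof -
  let ?L = "colimit_topology I F M"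
  let ?q = "\<lambda>(i, x). colimit_inj F M i x"
  let ?g = "\<lambda>(i, x). g i x"
  have q: "quotient_map (sum_topology F I) ?L ?q" by (rule quotient_map_colimit_topology)
  have contg: "continuous_map (sum_topology F I) Y ?g"
  proof -
    have "continuous_map (F i) Y (?g \<circ> (\<lambda>x. (i, x)))" if "i \<in> I" for i
      using cont[OF that] by (simp add: o_def)
    then show ?thesis
      by (auto simp: continuous_map_def openin_sum_topology Pi_iff split: prod.splits)
  qed
  have inv: "?g p = ?g p'" if "equivclp (glue F M) p p'" for p p'
    using that
  proof (induction rule: equivclp_induct)
    case base
    show ?case by simp
  next
    case (step y z)
    then show ?case using cocone by (fastforce simp: glue_def)
  qed
  have inv': "?g p = ?g p'" if "?q p = ?q p'" for p p'
  proof -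
    have "p' \<in> ?q p'" by (auto simp: colimit_inj_def colimit_rel_def split: prod.splits)
    then have "p' \<in> ?q p" using that by simp
    then have "equivclp (glue F M) p p'"
      by (auto simp: colimit_inj_def colimit_rel_def split: prod.splits)
    then show ?thesis by (rule inv)
  qed
  obtain h where h: "continuous_map ?L Y h" "\<And>p. p \<in> topspace (sum_topology F I) \<Longrightarrow> h (?q p) = ?g p"
  proof (rule quotient_map_lift_exists[OF q contg])
    show "\<And>x y. \<lbrakk>x \<in> topspace (sum_topology F I); y \<in> topspace (sum_topology F I); ?q x = ?q y\<rbrakk>
            \<Longrightarrow> ?g x = ?g y" by (rule inv')
  qed (rule that, auto)
  have topL: "topspace ?L = ?q ` topspace (sum_topology F I)"
    using quotient_imp_surjective_map[OF q] by simp
  show ?thesis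
  proof (rule ex1I[of _ "restrict h (topspace ?L)"], intro conjI ballI)
    show "continuous_map ?L Y (restrict h (topspace ?L))"
      using h(1) continuous_map_eq by fastforce
  next
    fix i x assume *: "i \<in> I" "x \<in> topspace (F i)"
    then have "(i, x) \<in> topspace (sum_topology F I)" by simp
    then show "restrict h (topspace ?L) (colimit_inj F M i x) = g i x"
      using h(2)[of "(i, x)"] unfolding topL by (auto intro!: image_eqI[of _ ?q "(i, x)"])
  next
    fix k assume k: "k \<in> extensional (topspace ?L) \<and> continuous_map ?L Y k \<and>
      (\<forall>i\<in>I. \<forall>x\<in>topspace (F i). k (colimit_inj F M i x) = g i x)"
    show "k = restrict h (topspace ?L)"
    proof (rule extensionalityI[of _ "topspace ?L"])
      fix c assume c: "c \<in> topspace ?L"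
      then obtain i x where "i \<in> I" "x \<in> topspace (F i)" "c = colimit_inj F M i x"
        unfolding topL by auto
      then show "k c = restrict h (topspace ?L) c"
        using k c h(2)[of "(i, x)"] by simp
    qed (use k in auto)
  qed auto
qed


section \<open>Geometric realization\<close>

text \<open>
  \<^const>\<open>standard_simplex\<close> realises $\mathbb{R}^{n+1}$ as the sequences vanishing beyond position
  \<open>n\<close>; the product topology restricts to the Euclidean topology on them.
\<close>

definition simplex_space :: "nat \<Rightarrow> (nat \<Rightarrow> real) topology" where
  "simplex_space n = subtopology (powertop_real UNIV) (standard_simplex n)"

definition simplex_push :: "nat \<Rightarrow> (nat \<Rightarrow> nat) \<Rightarrow> (nat \<Rightarrow> real) \<Rightarrow> (nat \<Rightarrow> real)" where
  "simplex_push n \<theta> t = (\<lambda>i. \<Sum>j | j \<le> n \<and> \<theta> j = i. t j)"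

text \<open>
  The category of simplices of \<open>C\<close>: an object \<open>(n, \<sigma>)\<close> is a map \<open>\<sigma>\<close> from \<open>representable n\<close> to \<open>C\<close>.
  Arrows carry a map of simplicial sets \<open>\<phi>\<close> between representables; by the Yoneda lemma, the
  corresponding map of ordinals, which acts on the topological simplices, is the image under \<open>\<phi>\<close> of
  the identity.
\<close>

definition simplex_objects :: "'a sset \<Rightarrow> (nat \<times> (nat \<Rightarrow> (nat \<Rightarrow> nat) \<Rightarrow> 'a)) set" where
  "simplex_objects C = {(n, \<sigma>). \<sigma> \<in> sset_hom (representable n) C}"

definition simplex_arrows ::
  "'a sset \<Rightarrow> ((nat \<times> (nat \<Rightarrow> (nat \<Rightarrow> nat) \<Rightarrow> 'a)) \<times> (nat \<Rightarrow> (nat \<Rightarrow> nat) \<Rightarrow> (nat \<Rightarrow> nat)) \<times>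
              (nat \<times> (nat \<Rightarrow> (nat \<Rightarrow> nat) \<Rightarrow> 'a))) set" where
  "simplex_arrows C =
     {((n, \<sigma>), \<phi>, (m, \<tau>)) | n \<sigma> \<phi> m \<tau>.
        (n, \<sigma>) \<in> simplex_objects C \<and> (m, \<tau>) \<in> simplex_objects C \<and>
        \<phi> \<in> sset_hom (representable n) (representable m) \<and>
        sset_comp (representable n) \<tau> \<phi> = \<sigma>}"

definition geometric_realization ::
  "'a sset \<Rightarrow> ((nat \<times> (nat \<Rightarrow> (nat \<Rightarrow> nat) \<Rightarrow> 'a)) \<times> (nat \<Rightarrow> real)) set topology" where
  "geometric_realization C =
     colimit_topology (simplex_objects C) (\<lambda>(n, \<sigma>). simplex_space n)
       {((n, \<sigma>), simplex_push n (\<phi> n (ord_id n)), (m, \<tau>)) | n \<sigma> \<phi> m \<tau>.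
          ((n, \<sigma>), \<phi>, (m, \<tau>)) \<in> simplex_arrows C}"

lemma simplex_push_in_standard_simplex:
  assumes \<theta>: "\<theta> \<in> ord_maps n m" and t: "t \<in> standard_simplex n"
  shows "simplex_push n \<theta> t \<in> standard_simplex m"
proof -
  let ?s = "simplex_push n \<theta> t"
  have ran: "\<theta> j \<le> m" if "j \<le> n" for j
    using \<theta> that by (auto simp: ord_maps_def PiE_iff)
  have nn: "0 \<le> t j" for j
    using t by (auto simp: standard_simplex_def)
  have s0: "0 \<le> ?s i" for i
    unfolding simplex_push_def by (intro sum_nonneg) (auto intro: nn)
  have sz: "?s i = 0" if "m < i" for i
    unfolding simplex_push_def using that ran by (intro sum.neutral) force
  have "(\<Sum>i\<le>m. ?s i) = (\<Sum>j\<le>n. t j)"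
    using sum.group[of "{..n}" "{..m}" \<theta> t] ran by (auto simp: simplex_push_def image_subset_iff)
  then have s1: "(\<Sum>i\<le>m. ?s i) = 1"
    using t by (simp add: standard_simplex_def)
  have "?s i \<le> 1" for i
  proof (cases "i \<le> m")
    case True
    then have "?s i \<le> (\<Sum>i\<le>m. ?s i)" by (intro member_le_sum) (auto intro: s0)
    then show ?thesis by (simp add: s1)
  qed (simp add: sz)
  then show ?thesis using s0 sz s1 by (simp add: standard_simplex_def)
qed

lemma continuous_map_simplex_push:
  assumes "\<theta> \<in> ord_maps n m"
  shows "continuous_map (simplex_space n) (simplex_space m) (simplex_push n \<theta>)"
proof -
  have "continuous_map (simplex_space n) euclideanreal (\<lambda>t. simplex_push n \<theta> t i)" for i
    unfolding simplex_push_def simplex_space_def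
    by (intro continuous_map_sum continuous_map_from_subtopology continuous_map_product_projection)
       auto
  moreover have "simplex_push n \<theta> \<in> topspace (simplex_space n) \<rightarrow> standard_simplex m"
    using simplex_push_in_standard_simplex[OF assms] by (auto simp: simplex_space_def)
  ultimately show ?thesis
    unfolding simplex_space_def[of m]
    by (auto simp: continuous_map_in_subtopology continuous_map_componentwise_UNIV)
qed

lemma simplex_arrow_ord_map:
  assumes "((n, \<sigma>), \<phi>, (m, \<tau>)) \<in> simplex_arrows C"
  shows "\<phi> n (ord_id n) \<in> ord_maps n m"
proof -
  have "\<phi> n \<in> ord_maps n n \<rightarrow>\<^sub>E ord_maps n m"
    using assms by (auto simp: simplex_arrows_def sset_hom_def representable_def)
  then show ?thesis using ord_id_in_ord_maps by (auto simp: PiE_iff)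
qed

end

theory Submission
  imports Defs
begin

text \<open>
  A point of $|\mathcal{S}(P)|$ is a probability measure on \<open>P\<close> supported on a chain: a point of the
  simplex attached to \<open>f\<close> is sent to its image measure under \<open>f\<close>.  This is a continuous bijection from
  a compact space to a Hausdorff space.  Since
  $\mathcal{S}(P) \times \mathcal{S}(Q) \cong \mathcal{S}(P \times Q)$, it remains to see that a
  measure on a chain of \<open>P \<times> Q\<close> is determined by its two marginals, and that these can be
  prescribed arbitrarily.  Indeed, stacking the masses of the two marginals along their supporting
  chains gives two partitions of the unit interval, and the mass of \<open>(p, q)\<close> has to be the length of
  the intersection of the intervals belonging to \<open>p\<close> and \<open>q\<close>.
\<close>

section \<open>Measures supported on chains\<close>

text \<open>The points of the order complex of \<open>P\<close> in barycentric coordinates, extended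
  by zero to the whole type; the last condition says that the support is a chain.\<close>

definition chain_measures :: "'p set \<Rightarrow> 'p rel \<Rightarrow> ('p \<Rightarrow> real) set" where
  "chain_measures P r =
     {t. (\<forall>p. 0 \<le> t p) \<and> (\<forall>p. p \<notin> P \<longrightarrow> t p = 0) \<and> (\<Sum>p\<in>P. t p) = 1 \<and>
         (\<forall>p q. t p \<noteq> 0 \<longrightarrow> t q \<noteq> 0 \<longrightarrow> (p, q) \<in> r \<or> (q, p) \<in> r)}"

definition chain_space :: "'p set \<Rightarrow> 'p rel \<Rightarrow> ('p \<Rightarrow> real) topology" where
  "chain_space P r = subtopology (powertop_real UNIV) (chain_measures P r)"

text \<open>The formula of \<open>simplex_push\<close> with an arbitrary type of target vertices.
  Over \<open>nat\<close> the two agree, so that results on chains of posets apply to faces of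
  simplices.\<close>

definition pushforward :: "nat \<Rightarrow> (nat \<Rightarrow> 'p) \<Rightarrow> (nat \<Rightarrow> real) \<Rightarrow> 'p \<Rightarrow> real" where
  "pushforward n f x = (\<lambda>p. \<Sum>j | j \<le> n \<and> f j = p. x j)"

lemma chain_measuresD:
  assumes "t \<in> chain_measures P r"
  shows "0 \<le> t p" "p \<notin> P \<Longrightarrow> t p = 0" "(\<Sum>p\<in>P. t p) = 1"
    "t p \<noteq> 0 \<Longrightarrow> t q \<noteq> 0 \<Longrightarrow> (p, q) \<in> r \<or> (q, p) \<in> r"
  using assms by (auto simp: chain_measures_def)

lemma topspace_chain_space [simp]: "topspace (chain_space P r) = chain_measures P r"
  by (simp add: chain_space_def)

lemma Hausdorff_space_chain_space: "Hausdorff_space (chain_space P r)"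
  unfolding chain_space_def
  by (intro Hausdorff_space_subtopology) (simp add: Hausdorff_space_product_topology)

lemma sum_chain_measure:
  assumes "t \<in> chain_measures P r" "finite P" "{p. t p \<noteq> 0} \<subseteq> A" "A \<subseteq> P"
  shows "(\<Sum>p\<in>A. t p) = 1"
proof -
  have "(\<Sum>p\<in>A. t p) = (\<Sum>p\<in>P. t p)"
    using assms by (intro sum.mono_neutral_left) auto
  then show ?thesis using assms(1) by (simp add: chain_measures_def)
qed

text \<open>The number of elements of \<open>A\<close> strictly below a point is strictly monotone
  along the chain and less than \<open>card A\<close>, hence a bijection onto an initial segment of
  the naturals. Its inverse lists \<open>A\<close> in increasing order.\<close>

lemma chain_enumeration:
  assumes A: "finite A" "A \<noteq> {}" "A \<subseteq> P" and r: "partial_order_on P r"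
    and chain: "\<And>x y. x \<in> A \<Longrightarrow> y \<in> A \<Longrightarrow> (x, y) \<in> r \<or> (y, x) \<in> r"
  obtains m e where "e \<in> simp_of (poset_sset P r) m" "bij_betw e {..m} A"
proof -
  note po = partial_order_onD[OF r]
  define below where "below x = {a \<in> A. (a, x) \<in> r \<and> a \<noteq> x}" for x
  define rank where "rank x = card (below x)" for x
  have fin: "finite (below x)" for x
    using A(1) by (simp add: below_def)
  have less: "rank x < rank y" if "(x, y) \<in> r" "x \<noteq> y" "x \<in> A" "y \<in> A" for x y
  proof -
    have "below x \<subseteq> below y"
      using that po(2,3) by (auto simp: below_def dest: transD antisymD)
    moreover have "x \<in> below y" "x \<notin> below x"
      using that by (auto simp: below_def)
    ultimately show ?thesis
      unfolding rank_def using fin by (intro psubset_card_mono) auto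
  qed
  have inj: "inj_on rank A"
    by (rule inj_onI) (metis chain less less_irrefl)
  have "rank x < card A" if "x \<in> A" for x
    unfolding rank_def using that A(1) by (intro psubset_card_mono) (auto simp: below_def)
  then have "rank ` A \<subseteq> {..<card A}" by auto
  then have "rank ` A = {..<card A}"
    using A(1) inj by (intro card_subset_eq) (auto simp: card_image)
  moreover obtain m where m: "card A = Suc m"
    using A by (metis card_eq_0_iff not0_implies_Suc)
  ultimately have bij: "bij_betw rank A {..m}"
    using inj by (auto simp: bij_betw_def lessThan_Suc_atMost)
  define e where "e = restrict (inv_into A rank) {..m}"
  have e: "bij_betw e {..m} A"
    using bij_betw_inv_into[OF bij] bij_betw_cong[of "{..m}" "inv_into A rank" e A]
    by (simp add: e_def)
  have rank_e: "rank (e i) = i" if "i \<le> m" for i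
    using bij that by (simp add: e_def bij_betw_inv_into_right)
  have mem: "e i \<in> A" if "i \<le> m" for i
    using e that by (auto simp: bij_betw_def)
  have "(e i, e j) \<in> r" if "i \<le> j" "j \<le> m" for i j
  proof (cases "e i = e j")
    case True
    then show ?thesis using chain[OF mem mem, of j j] that by simp
  next
    case False
    have "\<not> (e j, e i) \<in> r"
      using less[of "e j" "e i"] False that rank_e[of i] rank_e[of j] mem by auto
    then show ?thesis using chain[OF mem mem, of i j] that by simp
  qed
  then have "e \<in> simp_of (poset_sset P r) m"
    using mem A(3) by (auto simp: poset_sset_def monotone_on_def e_def)
  from that[OF this e] show ?thesis .
qed

text \<open>A failure would, by monotonicity, give the reverse relation, and antisymmetry would then
  merge two values of an injective map.\<close>

lemma poset_simplex_reflects: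
  assumes e: "e \<in> simp_of (poset_sset P r) m" "inj_on e {..m}" and r: "partial_order_on P r"
    and "(e i, e j) \<in> r" "i \<le> m" "j \<le> m"
  shows "i \<le> j"
proof (rule ccontr)
  assume "\<not> i \<le> j"
  then have "(e j, e i) \<in> r"
    using e(1) assms(5,6) by (auto simp: poset_sset_def monotone_on_def)
  then have "e i = e j"
    using assms(4) partial_order_onD(3)[OF r] by (auto dest: antisymD)
  with e(2) assms(5,6) \<open>\<not> i \<le> j\<close> show False by (auto dest: inj_onD)
qed

section \<open>Image measures of points of a simplex\<close>

lemma pushforward_inj:
  assumes "inj_on e {..m}" "i \<le> m"
  shows "pushforward m e y (e i) = y i"
proof -
  have "{j. j \<le> m \<and> e j = e i} = {i}"
    using assms by (auto dest: inj_onD)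
  then show ?thesis by (simp add: pushforward_def)
qed

lemma pushforward_eq_0:
  assumes "p \<notin> f ` {..n}"
  shows "pushforward n f x p = 0"
  unfolding pushforward_def using assms by (intro sum.neutral) auto

text \<open>Nonnegative masses cannot cancel, so a vertex of positive weight is sent into the
  support of the image measure.\<close>

lemma pushforward_ge:
  assumes "\<And>j. 0 \<le> x j" "i \<le> n"
  shows "x i \<le> pushforward n f x (f i)"
  unfolding pushforward_def using assms by (intro member_le_sum) auto

text \<open>Grouping indices by their value under \<open>\<theta>\<close> gives functoriality of
  image measures, which makes the maps into spaces of measures compatible with the gluing in a
  realization.\<close>

lemma pushforward_simplex_push:
  assumes "\<theta> \<in> ord_maps n m"
  shows "pushforward m f (simplex_push n \<theta> x) = pushforward n (compose {..n} f \<theta>) x"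
proof
  fix p
  have ran: "\<theta> j \<le> m" if "j \<le> n" for j
    using assms that by (auto simp: ord_maps_def PiE_iff)
  let ?S = "{j. j \<le> n \<and> f (\<theta> j) = p}"
  have "pushforward m f (simplex_push n \<theta> x) p =
        (\<Sum>i | i \<le> m \<and> f i = p. \<Sum>j | j \<in> ?S \<and> \<theta> j = i. x j)"
    unfolding pushforward_def simplex_push_def
    by (intro sum.cong) (auto intro!: arg_cong[where f = "sum x"])
  also have "\<dots> = (\<Sum>j\<in>?S. x j)"
    using ran by (intro sum.group) auto
  also have "\<dots> = pushforward n (compose {..n} f \<theta>) x p"
    unfolding pushforward_def by (intro sum.cong) (auto simp: compose_def)
  finally show "pushforward m f (simplex_push n \<theta> x) p = pushforward n (compose {..n} f \<theta>) x p" .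
qed

lemma pushforward_in_chain_measures:
  assumes f: "f \<in> simp_of (poset_sset P r) n" and x: "x \<in> standard_simplex n" and P: "finite P"
  shows "pushforward n f x \<in> chain_measures P r"
proof -
  have mem: "f j \<in> P" if "j \<le> n" for j
    using f that by (auto simp: poset_sset_def)
  have mono: "(f i, f j) \<in> r" if "i \<le> j" "j \<le> n" for i j
    using f that by (auto simp: poset_sset_def monotone_on_def)
  have "0 \<le> pushforward n f x p" for p
    unfolding pushforward_def using x by (intro sum_nonneg) (auto simp: standard_simplex_def)
  moreover have "pushforward n f x p = 0" if "p \<notin> P" for p
    using that mem by (intro pushforward_eq_0) auto
  moreover have "(\<Sum>p\<in>P. pushforward n f x p) = 1"
  proof -
    have "(\<Sum>p\<in>P. pushforward n f x p) = (\<Sum>j\<le>n. x j)"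
      using sum.group[of "{..n}" P f x] mem P by (auto simp: pushforward_def image_subset_iff)
    then show ?thesis using x by (simp add: standard_simplex_def)
  qed
  moreover have "(p, q) \<in> r \<or> (q, p) \<in> r"
    if pq: "pushforward n f x p \<noteq> 0" "pushforward n f x q \<noteq> 0" for p q
  proof -
    obtain i j where ij: "i \<le> n" "p = f i" "j \<le> n" "q = f j"
      using pq pushforward_eq_0[of _ f n x] by blast
    show ?thesis
      using mono[of i j] mono[of j i] ij by (cases "i \<le> j") auto
  qed
  ultimately show ?thesis by (simp add: chain_measures_def)
qed

lemma continuous_map_pushforward:
  assumes "f \<in> simp_of (poset_sset P r) n" "finite P"
  shows "continuous_map (simplex_space n) (chain_space P r) (pushforward n f)"
proof -
  have "continuous_map (simplex_space n) euclideanreal (\<lambda>x. pushforward n f x p)" for p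
    unfolding pushforward_def simplex_space_def
    by (intro continuous_map_sum continuous_map_from_subtopology continuous_map_product_projection)
       auto
  moreover have "pushforward n f \<in> topspace (simplex_space n) \<rightarrow> chain_measures P r"
    using pushforward_in_chain_measures[OF assms(1) _ assms(2)] by (auto simp: simplex_space_def)
  ultimately show ?thesis
    unfolding chain_space_def
    by (auto simp: continuous_map_in_subtopology continuous_map_componentwise_UNIV)
qed

text \<open>The simplex lists the support of \<open>t\<close> in increasing order and
  \<open>y\<close> copies the masses. The support is nonempty because the total mass is one.\<close>

lemma chain_measure_representation:
  assumes t: "t \<in> chain_measures P r" and P: "finite P" "partial_order_on P r"
  obtains m e y where "e \<in> simp_of (poset_sset P r) m" "bij_betw e {..m} {p. t p \<noteq> 0}"
    "y \<in> standard_simplex m" "pushforward m e y = t"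
proof -
  let ?A = "{p. t p \<noteq> 0}"
  have sub: "?A \<subseteq> P" using t by (auto simp: chain_measures_def)
  then have fin: "finite ?A" using P(1) by (rule finite_subset)
  have sum1: "(\<Sum>p\<in>?A. t p) = 1"
    using sum_chain_measure[OF t P(1) subset_refl sub] .
  then have ne: "?A \<noteq> {}"
    by (metis sum.empty zero_neq_one)
  obtain m e where e: "e \<in> simp_of (poset_sset P r) m" and bij: "bij_betw e {..m} ?A"
    by (rule chain_enumeration[OF fin ne sub P(2)]) (use t in \<open>auto simp: chain_measures_def\<close>)
  \<comment> \<open>Points of \<open>standard_simplex m\<close> must vanish beyond \<open>m\<close>,
    whence the default 0.\<close>
  define y where "y i = (if i \<le> m then t (e i) else 0)" for i
  have y0: "0 \<le> y i" for i using t by (auto simp: y_def chain_measures_def)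
  have "(\<Sum>i\<le>m. y i) = (\<Sum>p\<in>?A. t p)"
    using sum.reindex_bij_betw[OF bij, of t] by (simp add: y_def)
  then have y1: "(\<Sum>i\<le>m. y i) = 1" by (simp add: sum1)
  have "y i \<le> 1" for i
  proof (cases "i \<le> m")
    case True
    then have "y i \<le> (\<Sum>i\<le>m. y i)" by (intro member_le_sum) (auto intro: y0)
    then show ?thesis by (simp add: y1)
  qed (simp add: y_def)
  then have y: "y \<in> standard_simplex m"
    using y0 y1 by (simp add: standard_simplex_def) (simp add: y_def)
  have "pushforward m e y = t"
  proof
    fix p
    show "pushforward m e y p = t p"
    proof (cases "p \<in> ?A")
      case True
      then obtain i where "i \<le> m" "p = e i"
        using bij by (auto simp: bij_betw_def)
      then show ?thesis
        using bij by (simp add: pushforward_inj bij_betw_imp_inj_on y_def)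
    next
      case False
      then show ?thesis
        using bij pushforward_eq_0[of p e m y] by (auto simp: bij_betw_def)
    qed
  qed
  with e bij y show ?thesis by (rule that)
qed

section \<open>Realizations as spaces of measures\<close>

definition yoneda :: "'a sset \<Rightarrow> nat \<Rightarrow> 'a \<Rightarrow> nat \<Rightarrow> (nat \<Rightarrow> nat) \<Rightarrow> 'a" where
  "yoneda C n c = (\<lambda>k. \<lambda>\<theta>\<in>ord_maps k n. act_of C k n \<theta> c)"

lemma simplicial_set_act_in:
  "simplicial_set C \<Longrightarrow> \<theta> \<in> ord_maps k l \<Longrightarrow> x \<in> simp_of C l \<Longrightarrow> act_of C k l \<theta> x \<in> simp_of C k"
  by (auto simp: simplicial_set_def)

lemma simplicial_set_act_compose:
  "simplicial_set C \<Longrightarrow> \<theta> \<in> ord_maps k l \<Longrightarrow> \<eta> \<in> ord_maps l m \<Longrightarrow> x \<in> simp_of C m \<Longrightarrow>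
   act_of C k m (compose {..k} \<eta> \<theta>) x = act_of C k l \<theta> (act_of C l m \<eta> x)"
  by (auto simp: simplicial_set_def)

lemma yoneda_in_sset_hom:
  assumes "simplicial_set C" "c \<in> simp_of C n"
  shows "yoneda C n c \<in> sset_hom (representable n) C"
proof -
  have "yoneda C n c k \<in> simp_of (representable n) k \<rightarrow>\<^sub>E simp_of C k" for k
    using simplicial_set_act_in[OF assms(1) _ assms(2)] by (auto simp: yoneda_def representable_def)
  moreover have "yoneda C n c k (act_of (representable n) k l \<theta> f) = act_of C k l \<theta> (yoneda C n c l f)"
    if "\<theta> \<in> ord_maps k l" "f \<in> simp_of (representable n) l" for k l \<theta> f
    using that compose_in_ord_maps[of \<theta> k l f n]
      simplicial_set_act_compose[OF assms(1) that(1) _ assms(2), of f]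
    by (simp add: yoneda_def representable_def)
  ultimately show ?thesis by (simp add: sset_hom_def)
qed

lemma yoneda_ord_id:
  assumes "simplicial_set C" "c \<in> simp_of C n"
  shows "yoneda C n c n (ord_id n) = c"
  using assms ord_id_in_ord_maps[of n] by (simp add: yoneda_def simplicial_set_def)

lemma compose_ord_id: "\<theta> \<in> ord_maps k n \<Longrightarrow> compose {..k} (ord_id n) \<theta> = \<theta>"
  by (auto simp: ord_maps_def compose_def PiE_iff fun_eq_iff extensional_def)

text \<open>Every \<open>\<theta>\<close> is \<open>ord_id n\<close> pulled back along
  \<open>\<theta>\<close>, so naturality determines \<open>\<sigma>\<close> by its value at the
  identity. Away from \<open>ord_maps k n\<close> both sides are \<open>undefined\<close>.\<close>

lemma sset_hom_eq_yoneda: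
  assumes "\<sigma> \<in> sset_hom (representable n) C"
  shows "\<sigma> n (ord_id n) \<in> simp_of C n" "\<sigma> = yoneda C n (\<sigma> n (ord_id n))"
proof -
  have fn: "\<sigma> k \<in> ord_maps k n \<rightarrow>\<^sub>E simp_of C k" for k
    using assms by (auto simp: sset_hom_def representable_def)
  have nat: "\<sigma> k (compose {..k} f \<theta>) = act_of C k l \<theta> (\<sigma> l f)"
    if "\<theta> \<in> ord_maps k l" "f \<in> ord_maps l n" for k l \<theta> f
    using assms that by (auto simp: sset_hom_def representable_def)
  show "\<sigma> n (ord_id n) \<in> simp_of C n"
    using fn ord_id_in_ord_maps by blast
  show "\<sigma> = yoneda C n (\<sigma> n (ord_id n))"
  proof (intro ext)
    fix k \<theta>
    show "\<sigma> k \<theta> = yoneda C n (\<sigma> n (ord_id n)) k \<theta>"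
    proof (cases "\<theta> \<in> ord_maps k n")
      case True
      then show ?thesis
        using nat[OF True ord_id_in_ord_maps] unfolding compose_ord_id[OF True]
        by (simp only: yoneda_def restrict_apply if_True)
    next
      case False
      then show ?thesis
        using PiE_arb[OF fn False] by (simp only: yoneda_def restrict_apply if_False)
    qed
  qed
qed

lemma yoneda_in_simplex_objects:
  "simplicial_set C \<Longrightarrow> c \<in> simp_of C n \<Longrightarrow> (n, yoneda C n c) \<in> simplex_objects C"
  by (simp add: simplex_objects_def yoneda_in_sset_hom)

text \<open>Functoriality of the action of \<open>C\<close>, read through the Yoneda correspondence.
  It provides the arrow that glues a face or degeneracy of \<open>c\<close> to
  \<open>c\<close>.\<close>

lemma sset_comp_yoneda:
  assumes "simplicial_set C" "c \<in> simp_of C m" "\<theta> \<in> ord_maps n m"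
  shows "sset_comp (representable n) (yoneda C m c) (yoneda (representable m) n \<theta>) =
         yoneda C n (act_of C n m \<theta> c)"
proof (intro ext)
  fix k f
  show "sset_comp (representable n) (yoneda C m c) (yoneda (representable m) n \<theta>) k f =
        yoneda C n (act_of C n m \<theta> c) k f"
    using compose_in_ord_maps[of f k n \<theta> m] simplicial_set_act_compose[OF assms(1) _ assms(3,2), of f k]
      assms(3)
    by (simp add: sset_comp_def yoneda_def representable_def compose_def[of "ord_maps k n"])
qed

text \<open>The characteristic map of the simplex \<open>c\<close>. Indexing by elements of
  \<open>simp_of C n\<close> instead of maps out of \<open>representable n\<close> keeps the Yoneda
  lemma out of the later geometric arguments.\<close>

definition cell :: "'a sset \<Rightarrow> nat \<Rightarrow> 'a \<Rightarrow> (nat \<Rightarrow> real) \<Rightarrow>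
    ((nat \<times> (nat \<Rightarrow> (nat \<Rightarrow> nat) \<Rightarrow> 'a)) \<times> (nat \<Rightarrow> real)) set" where
  "cell C n c =
     colimit_inj (\<lambda>(n, \<sigma>). simplex_space n)
       {((n, \<sigma>), simplex_push n (\<phi> n (ord_id n)), (m, \<tau>)) | n \<sigma> \<phi> m \<tau>.
          ((n, \<sigma>), \<phi>, (m, \<tau>)) \<in> simplex_arrows C}
       (n, yoneda C n c)"

section \<open>Points and maps of a realization in terms of cells\<close>

lemma topspace_simplex_space [simp]: "topspace (simplex_space n) = standard_simplex n"
  by (simp add: simplex_space_def)

lemma compact_space_simplex_space: "compact_space (simplex_space n)"
  by (simp add: simplex_space_def compact_space_subtopology compactin_standard_simplex)

lemma continuous_map_cell:
  assumes "simplicial_set C" "c \<in> simp_of C n"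
  shows "continuous_map (simplex_space n) (geometric_realization C) (cell C n c)"
  using continuous_map_colimit_inj[OF yoneda_in_simplex_objects[OF assms],
      of "\<lambda>(n, \<sigma>). simplex_space n"]
  by (simp add: geometric_realization_def cell_def)

lemma colimit_topology_cases:
  assumes "z \<in> topspace (colimit_topology I F M)"
  obtains i x where "i \<in> I" "x \<in> topspace (F i)" "z = colimit_inj F M i x"
proof -
  have "z \<in> (\<lambda>(i, x). colimit_inj F M i x) ` topspace (sum_topology F I)"
    using assms quotient_imp_surjective_map[OF quotient_map_colimit_topology[of F I M]] by blast
  then show ?thesis using that by auto
qed

lemma geometric_realization_cases:
  assumes "z \<in> topspace (geometric_realization C)"
  obtains n c x where "c \<in> simp_of C n" "x \<in> standard_simplex n" "z = cell C n c x"
  using assms unfolding geometric_realization_def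
proof (rule colimit_topology_cases)
  fix i x
  assume i: "i \<in> simplex_objects C" and x: "x \<in> topspace (case i of (n, \<sigma>) \<Rightarrow> simplex_space n)"
    and z: "z = colimit_inj (\<lambda>(n, \<sigma>). simplex_space n)
       {((n, \<sigma>), simplex_push n (\<phi> n (ord_id n)), (m, \<tau>)) | n \<sigma> \<phi> m \<tau>.
          ((n, \<sigma>), \<phi>, (m, \<tau>)) \<in> simplex_arrows C} i x"
  obtain n \<sigma> where n: "i = (n, \<sigma>)" by (cases i)
  have \<sigma>: "\<sigma> \<in> sset_hom (representable n) C"
    using i by (simp add: n simplex_objects_def)
  have "z = cell C n (\<sigma> n (ord_id n)) x"
    unfolding z n cell_def sset_hom_eq_yoneda(2)[OF \<sigma>, symmetric] ..
  with sset_hom_eq_yoneda(1)[OF \<sigma>] x show thesis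
    by (intro that) (simp_all add: n)
qed

text \<open>The arrow of the simplex category that comes from \<open>\<theta>\<close> sends the
  identity to \<open>\<theta>\<close>, so the cocone identity for that arrow becomes a gluing rule
  for cells.\<close>

lemma cell_simplex_push:
  assumes C: "simplicial_set C" and c: "c \<in> simp_of C m" and \<theta>: "\<theta> \<in> ord_maps n m"
    and x: "x \<in> standard_simplex n"
  shows "cell C m c (simplex_push n \<theta> x) = cell C n (act_of C n m \<theta> c) x"
proof -
  let ?\<phi> = "yoneda (representable m) n \<theta>"
  have \<theta>': "\<theta> \<in> simp_of (representable m) n"
    using \<theta> by (simp add: representable_def)
  have arrow: "((n, yoneda C n (act_of C n m \<theta> c)), ?\<phi>, (m, yoneda C m c)) \<in> simplex_arrows C"
    using sset_comp_yoneda[OF C c \<theta>] C c \<theta>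
    by (simp add: simplex_arrows_def yoneda_in_simplex_objects simplicial_set_act_in
        yoneda_in_sset_hom[OF simplicial_set_representable \<theta>'])
  have \<phi>: "?\<phi> n (ord_id n) = \<theta>"
    by (rule yoneda_ord_id[OF simplicial_set_representable \<theta>'])
  have "((n, yoneda C n (act_of C n m \<theta> c)), simplex_push n (?\<phi> n (ord_id n)), (m, yoneda C m c)) \<in>
    {((n, \<sigma>), simplex_push n (\<phi> n (ord_id n)), (m, \<tau>)) | n \<sigma> \<phi> m \<tau>.
          ((n, \<sigma>), \<phi>, (m, \<tau>)) \<in> simplex_arrows C}"
    using arrow by blast
  from colimit_inj_cocone[OF this[unfolded \<phi>], of x "\<lambda>(n, \<sigma>). simplex_space n"]
  show ?thesis
    using x by (simp add: cell_def)
qed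

text \<open>The universal property of the colimit, rewritten for families indexed by simplices; the
  Yoneda lemma translates both the family and its compatibility with arrows.\<close>

lemma continuous_map_from_geometric_realization:
  assumes C: "simplicial_set C"
    and cont: "\<And>n c. c \<in> simp_of C n \<Longrightarrow> continuous_map (simplex_space n) Y (g n c)"
    and compat: "\<And>n m \<theta> c x. c \<in> simp_of C m \<Longrightarrow> \<theta> \<in> ord_maps n m \<Longrightarrow> x \<in> standard_simplex n \<Longrightarrow>
      g m c (simplex_push n \<theta> x) = g n (act_of C n m \<theta> c) x"
  obtains h where "continuous_map (geometric_realization C) Y h"
    "\<And>n c x. c \<in> simp_of C n \<Longrightarrow> x \<in> standard_simplex n \<Longrightarrow> h (cell C n c x) = g n c x"
proof -
  let ?M = "{((n, \<sigma>), simplex_push n (\<phi> n (ord_id n)), (m, \<tau>)) | n \<sigma> \<phi> m \<tau>.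
          ((n, \<sigma>), \<phi>, (m, \<tau>)) \<in> simplex_arrows C}"
  let ?F = "\<lambda>(n, \<sigma>). simplex_space n :: (nat \<Rightarrow> real) topology"
  \<comment> \<open>An index \<open>(n, \<sigma>)\<close> stands for the simplex that
    \<open>\<sigma>\<close> assigns to the identity.\<close>
  define G where "G = (\<lambda>(n, \<sigma>). g n (\<sigma> n (ord_id n)))"
  have "\<exists>!h. h \<in> extensional (topspace (colimit_topology (simplex_objects C) ?F ?M)) \<and>
              continuous_map (colimit_topology (simplex_objects C) ?F ?M) Y h \<and>
              (\<forall>i\<in>simplex_objects C. \<forall>x\<in>topspace (?F i). h (colimit_inj ?F ?M i x) = G i x)"
  proof (rule colimit_universal)
    show "continuous_map (?F i) Y (G i)" if "i \<in> simplex_objects C" for i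
    proof -
      obtain n \<sigma> where i: "i = (n, \<sigma>)" by (cases i)
      then have "\<sigma> n (ord_id n) \<in> simp_of C n"
        using that sset_hom_eq_yoneda(1) by (simp add: simplex_objects_def)
      from cont[OF this] show ?thesis by (simp add: G_def i)
    qed
  next
    fix i f j x
    assume "(i, f, j) \<in> ?M" and x: "x \<in> topspace (?F i)"
    then obtain n \<sigma> \<phi> m \<tau> where i: "i = (n, \<sigma>)" "j = (m, \<tau>)" "f = simplex_push n (\<phi> n (ord_id n))"
      and arrow: "((n, \<sigma>), \<phi>, (m, \<tau>)) \<in> simplex_arrows C"
      by auto
    let ?\<theta> = "\<phi> n (ord_id n)"
    have \<theta>: "?\<theta> \<in> ord_maps n m"
      using arrow by (rule simplex_arrow_ord_map)
    have \<tau>: "\<tau> \<in> sset_hom (representable m) C" and \<sigma>: "\<sigma> = sset_comp (representable n) \<tau> \<phi>"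
      using arrow by (auto simp: simplex_arrows_def simplex_objects_def)
    have "\<sigma> n (ord_id n) = \<tau> n ?\<theta>"
      unfolding \<sigma> sset_comp_def
      by (subst compose_eq) (simp_all add: representable_def ord_id_in_ord_maps)
    also have "\<dots> = act_of C n m ?\<theta> (\<tau> m (ord_id m))"
      by (subst sset_hom_eq_yoneda(2)[OF \<tau>]) (simp add: yoneda_def \<theta>)
    finally show "G j (f x) = G i x"
      using compat[OF sset_hom_eq_yoneda(1)[OF \<tau>] \<theta>] x by (simp add: G_def i)
  qed
  then obtain h where h: "continuous_map (colimit_topology (simplex_objects C) ?F ?M) Y h"
    "\<And>i x. i \<in> simplex_objects C \<Longrightarrow> x \<in> topspace (?F i) \<Longrightarrow> h (colimit_inj ?F ?M i x) = G i x"
    by blast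
  show ?thesis
  proof (rule that)
    show "continuous_map (geometric_realization C) Y h"
      using h(1) by (simp add: geometric_realization_def)
    show "h (cell C n c x) = g n c x" if "c \<in> simp_of C n" "x \<in> standard_simplex n" for n c x
      using h(2)[OF yoneda_in_simplex_objects[OF C that(1)], of x] that
      by (simp add: cell_def G_def yoneda_ord_id[OF C that(1)] del: restrict_apply)
  qed
qed

text \<open>
  On the face \<open>\<iota>\<close> of \<open>c\<close> spanned by the support of \<open>x\<close>, the map \<open>v n c\<close> factors through the injective
  \<open>v m d\<close>, which identifies this face with a degeneracy of a face of \<open>d\<close>.
\<close>

lemma cell_eq_nondegenerate_cell:
  assumes C: "simplicial_set C" and v: "v \<in> sset_hom C (poset_sset P r)"
    and bij: "\<And>k. bij_betw (v k) (simp_of C k) (simp_of (poset_sset P r) k)"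
    and r: "partial_order_on P r"
    and c: "c \<in> simp_of C n" and x: "x \<in> standard_simplex n"
    and d: "d \<in> simp_of C m" and y: "y \<in> standard_simplex m" and inj: "inj_on (v m d) {..m}"
    and eq: "pushforward n (v n c) x = pushforward m (v m d) y"
  shows "cell C n c x = cell C m d y"
proof -
  have vin: "v k a \<in> simp_of (poset_sset P r) k" if "a \<in> simp_of C k" for k a
    using v that by (auto simp: sset_hom_def)
  have vact: "v k (act_of C k l \<theta> a) = compose {..k} (v l a) \<theta>"
    if "\<theta> \<in> ord_maps k l" "a \<in> simp_of C l" for k l \<theta> a
    using v that by (auto simp: sset_hom_def poset_sset_def)
  \<comment> \<open>The ordinal \<open>{..n}\<close> is itself a poset, with \<open>x\<close> as a
    chain measure on it; representing \<open>x\<close> there yields the face \<open>\<iota>\<close>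
    spanned by its support.\<close>
  have le: "partial_order_on {..n} {(i, j). i \<le> j \<and> j \<le> n}"
    by (auto simp: partial_order_on_def preorder_on_def refl_on_def trans_def antisym_def)
  have id: "ord_id n \<in> simp_of (poset_sset {..n} {(i, j). i \<le> j \<and> j \<le> n}) n"
    using ord_id_in_ord_maps by (simp flip: representable_eq_poset_sset) (simp add: representable_def)
  have push_id: "pushforward n (ord_id n) x = x"
  proof
    show "pushforward n (ord_id n) x i = x i" for i
    proof (cases "i \<le> n")
      case True
      then show ?thesis using pushforward_inj[of "ord_id n" n i x] by simp
    next
      case False
      then show ?thesis
        using x pushforward_eq_0[of i "ord_id n" n x] by (auto simp: standard_simplex_def)
    qed
  qed
  have "x \<in> chain_measures {..n} {(i, j). i \<le> j \<and> j \<le> n}"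
    using pushforward_in_chain_measures[OF id x] by (simp add: push_id)
  then obtain k \<iota> x' where "\<iota> \<in> simp_of (poset_sset {..n} {(i, j). i \<le> j \<and> j \<le> n}) k"
    and supp: "bij_betw \<iota> {..k} {i. x i \<noteq> 0}"
    and x': "x' \<in> standard_simplex k" and "pushforward k \<iota> x' = x"
    by (rule chain_measure_representation[OF _ _ le]) auto
  then have \<iota>: "\<iota> \<in> ord_maps k n"
    by (simp flip: representable_eq_poset_sset) (simp add: representable_def)
  have \<iota>x': "simplex_push k \<iota> x' = x"
    using \<open>pushforward k \<iota> x' = x\<close> by (simp add: simplex_push_def pushforward_def)
  let ?f = "v n c" and ?e = "v m d"
  have \<iota>_le: "\<iota> j \<le> n" if "j \<le> k" for j
    using \<iota> that by (auto simp: ord_maps_def)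
  \<comment> \<open>The vertex \<open>\<iota> j\<close> has positive weight, so its image is charged
    by the common image measure, which lives on the vertices of \<open>d\<close>.\<close>
  have "?f (\<iota> j) \<in> ?e ` {..m}" if "j \<le> k" for j
  proof -
    have "x (\<iota> j) \<noteq> 0" using supp that by (auto simp: bij_betw_def)
    moreover have "0 \<le> x i" for i using x by (simp add: standard_simplex_def)
    ultimately have "pushforward n ?f x (?f (\<iota> j)) \<noteq> 0"
      using pushforward_ge[of x "\<iota> j" n ?f] \<iota>_le[OF that] by (metis order_antisym)
    then show ?thesis
      using pushforward_eq_0 unfolding eq by fastforce
  qed
  then have "\<forall>j\<in>{..k}. \<exists>i. i \<le> m \<and> ?e i = ?f (\<iota> j)"
    by (fastforce simp: image_iff)
  then obtain g0 where g0: "\<And>j. j \<le> k \<Longrightarrow> g0 j \<le> m" "\<And>j. j \<le> k \<Longrightarrow> ?e (g0 j) = ?f (\<iota> j)"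
    by (metis atMost_iff)
  \<comment> \<open>\<open>g0\<close> records the position in \<open>d\<close> of each vertex of the
    face, and \<open>ord_maps\<close> asks for an extensional map. Monotonicity will hold because
    \<open>?e\<close> reflects the order.\<close>
  define g where "g = restrict g0 {..k}"
  have g: "g \<in> ord_maps k m"
  proof -
    have "g i \<le> g j" if "i \<le> j" "j \<le> k" for i j
    proof -
      have "\<iota> i \<le> \<iota> j"
        using \<iota> that by (auto simp: ord_maps_def monotone_on_def)
      then have "(?f (\<iota> i), ?f (\<iota> j)) \<in> r"
        using vin[OF c] \<iota>_le[of j] that by (auto simp: poset_sset_def monotone_on_def)
      then have "(?e (g0 i), ?e (g0 j)) \<in> r"
        using g0 that by simp
      then show ?thesis
        using poset_simplex_reflects[OF vin[OF d] inj r] g0(1) that by (simp add: g_def)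
    qed
    then show ?thesis
      using g0(1) by (auto simp: ord_maps_def monotone_on_def g_def)
  qed
  \<comment> \<open>Both simplices have the same vertices in the poset, and \<open>v k\<close> is
    injective, so they coincide already in \<open>C\<close>.\<close>
  have "compose {..k} ?e g = compose {..k} ?f \<iota>"
    using g0 by (auto simp: compose_def g_def fun_eq_iff)
  then have v_eq: "v k (act_of C k m g d) = v k (act_of C k n \<iota> c)"
    by (simp add: vact g d \<iota> c)
  then have act_eq: "act_of C k m g d = act_of C k n \<iota> c"
    using bij_betw_imp_inj_on[OF bij[of k]] C g d \<iota> c by (auto dest: inj_onD intro: simplicial_set_act_in)
  \<comment> \<open>The image of \<open>x'\<close> under \<open>g\<close> and the point
    \<open>y\<close> have the same image measure under the injective \<open>?e\<close>, from which
    each coordinate can be read off.\<close>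
  let ?y = "simplex_push k g x'"
  have y': "?y \<in> standard_simplex m"
    using simplex_push_in_standard_simplex[OF g x'] .
  have "pushforward m ?e ?y = pushforward k (v k (act_of C k n \<iota> c)) x'"
    by (simp add: pushforward_simplex_push[OF g] vact[OF g d] flip: v_eq)
  also have "\<dots> = pushforward n ?f x"
    by (simp add: vact[OF \<iota> c] pushforward_simplex_push[OF \<iota>] flip: \<iota>x')
  finally have eq': "pushforward m ?e ?y = pushforward m ?e y"
    by (simp add: eq)
  have "?y = y"
  proof
    show "?y i = y i" for i
    proof (cases "i \<le> m")
      case True
      then show ?thesis using inj eq' by (metis pushforward_inj)
    next
      case False
      then show ?thesis using y y' by (simp add: standard_simplex_def)
    qed
  qed
  then have "cell C m d y = cell C k (act_of C k m g d) x'"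
    using cell_simplex_push[OF C d g x'] by simp
  also have "\<dots> = cell C n c x"
    using cell_simplex_push[OF C c \<iota> x'] by (simp add: act_eq \<iota>x')
  finally show ?thesis ..
qed

section \<open>Comparison of the realization with the space of measures\<close>

lemma finite_poset_simplices:
  assumes "finite P"
  shows "finite (simp_of (poset_sset P r) n)"
  by (rule finite_subset[OF _ finite_PiE[of "{..n}" "\<lambda>_. P"]]) (auto simp: poset_sset_def assms)

text \<open>Here \<open>C\<close> may be any simplicial set isomorphic to that of a poset, so that a
  product of two such sets is covered as well. Finitely many compact cells cover the realization
  because a chain in \<open>P\<close> has at most \<open>card P\<close> elements.\<close>

proposition geometric_realization_homeomorphic_chain_space:
  assumes C: "simplicial_set C" and v: "v \<in> sset_hom C (poset_sset P r)"
    and bij: "\<And>k. bij_betw (v k) (simp_of C k) (simp_of (poset_sset P r) k)"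
    and P: "finite P" and r: "partial_order_on P r"
  shows "compact_space (geometric_realization C)"
    and "geometric_realization C homeomorphic_space chain_space P r"
proof -
  let ?K = "chain_space P r" and ?R = "geometric_realization C"
  have vin: "v k a \<in> simp_of (poset_sset P r) k" if "a \<in> simp_of C k" for k a
    using v that by (auto simp: sset_hom_def)
  have vact: "v k (act_of C k l \<theta> a) = compose {..k} (v l a) \<theta>"
    if "\<theta> \<in> ord_maps k l" "a \<in> simp_of C l" for k l \<theta> a
    using v that by (auto simp: sset_hom_def poset_sset_def)
  obtain h where h: "continuous_map ?R ?K h"
    and h_cell: "\<And>n c x. c \<in> simp_of C n \<Longrightarrow> x \<in> standard_simplex n \<Longrightarrow>
      h (cell C n c x) = pushforward n (v n c) x"
  proof (rule continuous_map_from_geometric_realization[OF C])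
    show "continuous_map (simplex_space n) ?K (pushforward n (v n c))" if "c \<in> simp_of C n" for n c
      using continuous_map_pushforward[OF vin[OF that] P] .
    show "pushforward m (v m c) (simplex_push n \<theta> x) = pushforward n (v n (act_of C n m \<theta> c)) x"
      if "c \<in> simp_of C m" "\<theta> \<in> ord_maps n m" for n m \<theta> c x
      using that by (simp add: pushforward_simplex_push vact)
  qed (rule that)
  have rep: "\<exists>m d y. m < card P \<and> d \<in> simp_of C m \<and> inj_on (v m d) {..m} \<and>
      y \<in> standard_simplex m \<and> pushforward m (v m d) y = t" if t: "t \<in> chain_measures P r" for t
  proof -
    obtain m e y where e: "e \<in> simp_of (poset_sset P r) m" "bij_betw e {..m} {p. t p \<noteq> 0}"
      and y: "y \<in> standard_simplex m" "pushforward m e y = t"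
      using t P r by (rule chain_measure_representation)
    obtain d where d: "d \<in> simp_of C m" "v m d = e"
      using e(1) bij_betw_imp_surj_on[OF bij[of m]] by (metis imageE)
    have inj: "inj_on e {..m}"
      using e(2) by (rule bij_betw_imp_inj_on)
    moreover have "e ` {..m} \<subseteq> P"
      using e(1) by (auto simp: poset_sset_def)
    \<comment> \<open>The set \<open>{..m}\<close> has \<open>m + 1\<close> elements, hence the
      strict bound \<open>m < card P\<close>.\<close>
    ultimately have "card {..m} \<le> card P"
      using P by (rule card_inj_on_le)
    with d inj y show ?thesis by (intro exI[of _ m] exI[of _ d] exI[of _ y]) auto
  qed
  \<comment> \<open>By \<open>rep\<close> some nondegenerate simplex represents \<open>h z\<close>,
    and the identification of cells with equal image measure puts \<open>z\<close> on its
    cell.\<close>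
  have nondeg: "\<exists>m d y. m < card P \<and> d \<in> simp_of C m \<and> inj_on (v m d) {..m} \<and>
      y \<in> standard_simplex m \<and> z = cell C m d y \<and> pushforward m (v m d) y = h z"
    if zR: "z \<in> topspace ?R" for z
  proof -
    obtain n c x where nc: "c \<in> simp_of C n" "x \<in> standard_simplex n" and z: "z = cell C n c x"
      using zR by (rule geometric_realization_cases)
    have "h z \<in> chain_measures P r"
      using zR continuous_map_image_subset_topspace[OF h] by auto
    with rep obtain m d y where "m < card P" "d \<in> simp_of C m" "inj_on (v m d) {..m}"
      "y \<in> standard_simplex m" "pushforward m (v m d) y = h z" by blast
    moreover from this have "z = cell C m d y"
      using cell_eq_nondegenerate_cell[OF C v bij r nc, of d m y] h_cell[OF nc] z by simp
    ultimately show ?thesis by blast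
  qed
  have fin: "finite (simp_of C m)" for m
    using finite_poset_simplices[OF P] bij[of m] bij_betw_finite by blast
  \<comment> \<open>The cells of all simplices of dimension below \<open>card P\<close>, a finite
    family that contains every point by \<open>nondeg\<close>.\<close>
  define A where "A = (\<Union>m<card P. \<Union>d\<in>simp_of C m. {cell C m d ` standard_simplex m})"
  have cmp: "compactin ?R (cell C m d ` standard_simplex m)" if "d \<in> simp_of C m" for m d
    using image_compactin[OF _ continuous_map_cell[OF C that]] compact_space_simplex_space
    by (metis compact_space_def topspace_simplex_space)
  have "compactin ?R (\<Union>A)"
    by (rule compactin_Union) (auto simp: A_def fin cmp)
  moreover have "\<Union>A = topspace ?R"
  proof
    show "\<Union>A \<subseteq> topspace ?R"
      using calculation by (rule compactin_subset_topspace)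
    show "topspace ?R \<subseteq> \<Union>A"
      using nondeg by (fastforce simp: A_def)
  qed
  ultimately show cpt: "compact_space ?R" by (simp add: compact_space_def)
  have "inj_on h (topspace ?R)"
  proof (rule inj_onI)
    fix z z' assume z: "z \<in> topspace ?R" and z': "z' \<in> topspace ?R" and hz: "h z = h z'"
    obtain m d y where 1: "d \<in> simp_of C m" "inj_on (v m d) {..m}" "y \<in> standard_simplex m"
      "z = cell C m d y" "pushforward m (v m d) y = h z"
      using nondeg[OF z] by blast
    obtain n c x where 2: "c \<in> simp_of C n" "x \<in> standard_simplex n"
      "z' = cell C n c x" "pushforward n (v n c) x = h z'"
      using nondeg[OF z'] by blast
    \<comment> \<open>Both points lie on nondegenerate cells; that of \<open>z'\<close> serves as
      the arbitrary cell in the identification.\<close>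
    have "pushforward n (v n c) x = pushforward m (v m d) y"
      unfolding 1(5) 2(4) hz ..
    from cell_eq_nondegenerate_cell[OF C v bij r 2(1,2) 1(1,3,2) this] show "z = z'"
      unfolding 1(4) 2(3) ..
  qed
  moreover have "h ` topspace ?R = topspace ?K"
  proof
    show "h ` topspace ?R \<subseteq> topspace ?K"
      using h by (rule continuous_map_image_subset_topspace)
    show "topspace ?K \<subseteq> h ` topspace ?R"
    proof
      fix t assume "t \<in> topspace ?K"
      then obtain m d y where d: "d \<in> simp_of C m" and y: "y \<in> standard_simplex m"
        and t: "pushforward m (v m d) y = t"
        using rep[of t] by auto
      have "cell C m d y \<in> topspace ?R"
        using continuous_map_image_subset_topspace[OF continuous_map_cell[OF C d]] y by auto
      then show "t \<in> h ` topspace ?R"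
        using h_cell[OF d y] t by force
    qed
  qed
  ultimately have "homeomorphic_map ?R ?K h"
    using cpt h Hausdorff_space_chain_space by (intro continuous_imp_homeomorphic_map)
  then show "?R homeomorphic_space ?K"
    by (rule homeomorphic_map_imp_homeomorphic_space)
qed


section \<open>Monotone couplings\<close>

definition prod_order :: "'p rel \<Rightarrow> 'q rel \<Rightarrow> ('p \<times> 'q) rel" where
  "prod_order r s = {((p, q), (p', q')). (p, p') \<in> r \<and> (q, q') \<in> s}"

lemma partial_order_on_prod_order:
  assumes "partial_order_on P r" "partial_order_on Q s"
  shows "partial_order_on (P \<times> Q) (prod_order r s)"
proof -
  note r = partial_order_onD[OF assms(1)] and s = partial_order_onD[OF assms(2)]
  have "trans (prod_order r s)"
    using r(2) s(2) by (auto simp: trans_def prod_order_def)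
  moreover have "antisym (prod_order r s)"
    using r(3) s(3) by (auto simp: antisym_def prod_order_def)
  moreover have "refl_on (P \<times> Q) (prod_order r s)"
    using r(1) s(1) by (auto simp: refl_on_def prod_order_def)
  moreover have "prod_order r s \<subseteq> (P \<times> Q) \<times> (P \<times> Q)"
    using r(4) s(4) by (auto simp: prod_order_def)
  ultimately show ?thesis
    by (simp add: partial_order_on_def preorder_on_def)
qed

text \<open>The mass of the principal down-set of \<open>p\<close>, which is the right end of the
  interval of \<open>p\<close> when masses are stacked along the chain. Where \<open>t\<close>
  vanishes that interval has length zero.\<close>

definition cdf :: "'p set \<Rightarrow> 'p rel \<Rightarrow> ('p \<Rightarrow> real) \<Rightarrow> 'p \<Rightarrow> real" where
  "cdf P r t p = (\<Sum>x | x \<in> P \<and> (x, p) \<in> r. t x)"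

definition marginals :: "'p set \<Rightarrow> 'q set \<Rightarrow> ('p \<times> 'q \<Rightarrow> real) \<Rightarrow> ('p \<Rightarrow> real) \<times> ('q \<Rightarrow> real)" where
  "marginals P Q w = (\<lambda>p. \<Sum>q\<in>Q. w (p, q), \<lambda>q. \<Sum>p\<in>P. w (p, q))"

text \<open>
  The length of the intersection of the intervals from \<open>cdf P r s p - s p\<close> to \<open>cdf P r s p\<close> and from
  \<open>cdf Q r' t q - t q\<close> to \<open>cdf Q r' t q\<close>.  Points outside \<open>P\<close> and \<open>Q\<close> carry no mass and give \<open>0\<close>.
\<close>

definition coupling ::
  "'p set \<Rightarrow> 'p rel \<Rightarrow> ('p \<Rightarrow> real) \<Rightarrow> 'q set \<Rightarrow> 'q rel \<Rightarrow> ('q \<Rightarrow> real) \<Rightarrow> 'p \<times> 'q \<Rightarrow> real" where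
  "coupling P r s Q r' t = (\<lambda>(p, q).
     min (cdf P r s p) (cdf Q r' t q) - min (cdf P r s p - s p) (cdf Q r' t q)
     - min (cdf P r s p) (cdf Q r' t q - t q) + min (cdf P r s p - s p) (cdf Q r' t q - t q))"

text \<open>Exchanging the factors derives the second marginal of a coupling from the first.\<close>

lemma coupling_swap: "coupling P r s Q r' t (p, q) = coupling Q r' t P r s (q, p)"
  by (simp add: coupling_def min.commute)

text \<open>For \<open>p\<close> in \<open>P\<close>, reflexivity makes \<open>t p\<close> one of
  the summands of \<open>cdf\<close>; otherwise \<open>t p\<close> is zero. Left ends of intervals
  thus become masses of down-sets, like right ends.\<close>

lemma cdf_diff:
  assumes "finite P" "partial_order_on P r" "t \<in> chain_measures P r"
  shows "cdf P r t p - t p = (\<Sum>x | x \<in> P \<and> (x, p) \<in> r \<and> x \<noteq> p. t x)"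
proof (cases "p \<in> P")
  case True
  then have "(p, p) \<in> r"
    using partial_order_onD(1)[OF assms(2)] by (simp add: refl_on_def)
  moreover have "{x. x \<in> P \<and> (x, p) \<in> r \<and> x \<noteq> p} = {x. x \<in> P \<and> (x, p) \<in> r} - {p}" by auto
  ultimately show ?thesis
    using True assms(1) by (simp add: cdf_def sum_diff1)
next
  case False
  then have "{x. x \<in> P \<and> (x, p) \<in> r \<and> x \<noteq> p} = {x. x \<in> P \<and> (x, p) \<in> r}" by auto
  with False show ?thesis by (simp add: cdf_def chain_measuresD(2)[OF assms(3)])
qed

lemma cdf_bounds:
  assumes "finite P" "partial_order_on P r" "t \<in> chain_measures P r"
  shows "0 \<le> cdf P r t p - t p" "cdf P r t p \<le> 1"
proof -
  note nn = chain_measuresD(1)[OF assms(3)]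
  show "0 \<le> cdf P r t p - t p"
    unfolding cdf_diff[OF assms] by (intro sum_nonneg nn)
  have "cdf P r t p \<le> (\<Sum>x\<in>P. t x)"
    unfolding cdf_def using assms(1) nn by (intro sum_mono2) auto
  then show "cdf P r t p \<le> 1"
    using assms(3) by (simp add: chain_measures_def)
qed

text \<open>Transitivity and antisymmetry put the down-set of \<open>p\<close> inside the strict
  down-set of \<open>p'\<close>; nonnegative masses do the rest.\<close>

lemma cdf_less:
  assumes "finite P" "partial_order_on P r" "t \<in> chain_measures P r" "(p, p') \<in> r" "p \<noteq> p'"
  shows "cdf P r t p \<le> cdf P r t p' - t p'"
proof -
  note nn = chain_measuresD(1)[OF assms(3)]
  have "{x. x \<in> P \<and> (x, p) \<in> r} \<subseteq> {x. x \<in> P \<and> (x, p') \<in> r \<and> x \<noteq> p'}"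
    using assms(4,5) partial_order_onD(2,3)[OF assms(2)] by (auto dest: transD antisymD)
  then show ?thesis
    unfolding cdf_diff[OF assms(1-3)] unfolding cdf_def
    using assms(1) nn by (intro sum_mono2) auto
qed

text \<open>Along the support the left end of each interval is the right end of the one before,
  starting at 0 and ending at the total mass 1; terms off the support vanish. The function
  \<open>\<phi>\<close> stays arbitrary to admit the truncated lengths in a coupling.\<close>

lemma sum_cdf_telescope:
  fixes \<phi> :: "real \<Rightarrow> real"
  assumes P: "finite P" "partial_order_on P r" and t: "t \<in> chain_measures P r"
  shows "(\<Sum>p\<in>P. \<phi> (cdf P r t p) - \<phi> (cdf P r t p - t p)) = \<phi> 1 - \<phi> 0"
proof -
  let ?A = "{p. t p \<noteq> 0}"
  obtain m e y where e: "e \<in> simp_of (poset_sset P r) m" "bij_betw e {..m} ?A"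
    and y: "y \<in> standard_simplex m" "pushforward m e y = t"
    by (rule chain_measure_representation[OF t P])
  have inj: "inj_on e {..m}" and img: "e ` {..m} = ?A"
    using e(2) by (auto simp: bij_betw_def)
  have te: "t (e i) = y i" if "i \<le> m" for i
    using pushforward_inj[OF inj that, of y] y(2) by simp
  have sub: "?A \<subseteq> P" using t by (auto simp: chain_measures_def)
  \<comment> \<open>The strict bound makes \<open>Y i\<close> the left end and
    \<open>Y (Suc i)\<close> the right end of the interval of \<open>e i\<close>.\<close>
  define Y where "Y i = (\<Sum>j<i. y j)" for i
  have cdf_e: "cdf P r t (e i) = Y (Suc i)" if i: "i \<le> m" for i
  proof -
    \<comment> \<open>Since \<open>e\<close> both preserves and reflects the order, being below
      \<open>e i\<close> is a matter of indices.\<close>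
    have "{x. x \<in> ?A \<and> (x, e i) \<in> r} = e ` {..i}"
    proof
      show "{x. x \<in> ?A \<and> (x, e i) \<in> r} \<subseteq> e ` {..i}"
      proof
        fix x assume x: "x \<in> {x. x \<in> ?A \<and> (x, e i) \<in> r}"
        then have "x \<in> e ` {..m}" unfolding img by simp
        then obtain j where j: "j \<le> m" "x = e j" by auto
        then have "j \<le> i"
          using poset_simplex_reflects[OF e(1) inj P(2), of j i] i x by simp
        with j show "x \<in> e ` {..i}" by simp
      qed
      have "e j \<in> ?A" if "j \<le> i" for j
        unfolding img[symmetric] using that i by simp
      moreover have "(e j, e i) \<in> r" if "j \<le> i" for j
        using e(1) that i by (simp add: poset_sset_def monotone_on_def)
      ultimately show "e ` {..i} \<subseteq> {x. x \<in> ?A \<and> (x, e i) \<in> r}"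
        by (simp add: image_subset_iff)
    qed
    moreover have "cdf P r t (e i) = (\<Sum>x | x \<in> ?A \<and> (x, e i) \<in> r. t x)"
      unfolding cdf_def using P(1) sub by (intro sum.mono_neutral_right) auto
    moreover have "inj_on e {..i}"
      using inj_on_subset[OF inj, of "{..i}"] i by auto
    ultimately have "cdf P r t (e i) = (\<Sum>j\<le>i. t (e j))"
      by (simp add: sum.reindex)
    also have "\<dots> = Y (Suc i)"
      using i by (simp add: Y_def lessThan_Suc_atMost te)
    finally show ?thesis .
  qed
  have "(\<Sum>p\<in>P. \<phi> (cdf P r t p) - \<phi> (cdf P r t p - t p)) =
        (\<Sum>p\<in>?A. \<phi> (cdf P r t p) - \<phi> (cdf P r t p - t p))"
    using P(1) sub by (intro sum.mono_neutral_right) auto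
  also have "\<dots> = (\<Sum>i\<le>m. \<phi> (cdf P r t (e i)) - \<phi> (cdf P r t (e i) - t (e i)))"
    using sum.reindex_bij_betw[OF e(2), symmetric] .
  also have "\<dots> = (\<Sum>i\<le>m. \<phi> (Y (Suc i)) - \<phi> (Y i))"
    by (intro sum.cong) (simp_all add: cdf_e te, simp add: Y_def)
  also have "\<dots> = \<phi> (Y (Suc m)) - \<phi> (Y 0)"
    using sum_lessThan_telescope[of "\<lambda>i. \<phi> (Y i)" "Suc m"] by (simp only: lessThan_Suc_atMost)
  also have "\<dots> = \<phi> 1 - \<phi> 0"
    using y(1) by (simp add: Y_def lessThan_Suc_atMost standard_simplex_def del: sum.lessThan_Suc)
  finally show ?thesis .
qed

lemma sum_coupling:
  assumes P: "finite P" "partial_order_on P r" and Q: "finite Q" "partial_order_on Q r'"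
    and s: "s \<in> chain_measures P r" and t: "t \<in> chain_measures Q r'"
  shows "(\<Sum>q\<in>Q. coupling P r s Q r' t (p, q)) = s p"
proof -
  \<comment> \<open>\<open>\<phi> x\<close> is the length of the part of the interval of
    \<open>p\<close> to the left of \<open>x\<close>. As the interval lies between 0 and 1,
    \<open>\<phi> 1\<close> is its full length and \<open>\<phi> 0\<close> is zero.\<close>
  define \<phi> where "\<phi> x = min (cdf P r s p) x - min (cdf P r s p - s p) x" for x
  have "(\<Sum>q\<in>Q. coupling P r s Q r' t (p, q)) =
        (\<Sum>q\<in>Q. \<phi> (cdf Q r' t q) - \<phi> (cdf Q r' t q - t q))"
    by (intro sum.cong) (simp_all add: coupling_def \<phi>_def)
  also have "\<dots> = \<phi> 1 - \<phi> 0"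
    by (rule sum_cdf_telescope[OF Q t])
  also have "\<dots> = s p"
    using cdf_bounds[OF P s, of p] chain_measuresD(1)[OF s, of p] by (simp add: \<phi>_def min_def)
  finally show ?thesis .
qed

lemma coupling_in_chain_measures:
  assumes P: "finite P" "partial_order_on P r" and Q: "finite Q" "partial_order_on Q r'"
    and s: "s \<in> chain_measures P r" and t: "t \<in> chain_measures Q r'"
  shows "coupling P r s Q r' t \<in> chain_measures (P \<times> Q) (prod_order r r')"
proof -
  let ?S = "cdf P r s" and ?T = "cdf Q r' t" and ?w = "coupling P r s Q r' t"
  note s0 = chain_measuresD(1,2)[OF s] and t0 = chain_measuresD(1,2)[OF t]
  have "0 \<le> ?w (p, q)" for p q
    using s0(1)[of p] t0(1)[of q] by (auto simp: coupling_def min_def)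
  moreover have "?w z = 0" if "z \<notin> P \<times> Q" for z
    using that s0(2) t0(2) by (cases z) (auto simp: coupling_def)
  moreover have "(\<Sum>z\<in>P \<times> Q. ?w z) = 1"
    by (simp add: sum.cartesian_product' sum_coupling[OF assms] chain_measuresD(3)[OF s])
  moreover have "((p, q), (p', q')) \<in> prod_order r r' \<or> ((p', q'), (p, q)) \<in> prod_order r r'"
    if w: "?w (p, q) \<noteq> 0" "?w (p', q') \<noteq> 0" for p q p' q'
  proof -
    \<comment> \<open>A nonzero value means that the two intervals overlap in positive length, which
      gives strict inequalities between their ends.\<close>
    have overlap: "s p \<noteq> 0 \<and> t q \<noteq> 0 \<and> ?S p - s p < ?T q \<and> ?T q - t q < ?S p"
      if "?w (p, q) \<noteq> 0" for p q
      using that s0(1)[of p] t0(1)[of q] by (auto simp: coupling_def min_def split: if_splits)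
    have r: "(p, p') \<in> r \<or> (p', p) \<in> r" and r': "(q, q') \<in> r' \<or> (q', q) \<in> r'"
      using chain_measuresD(4)[OF s] chain_measuresD(4)[OF t] overlap[OF w(1)] overlap[OF w(2)] by auto
    \<comment> \<open>Otherwise the overlaps would close the cycle
      \<open>?S p \<le> ?S p' - s p' < ?T q' \<le> ?T q - t q < ?S p\<close>.\<close>
    have crossing: "p = p' \<or> q = q'"
      if "(p, p') \<in> r" "(q', q) \<in> r'" "?w (p, q) \<noteq> 0" "?w (p', q') \<noteq> 0" for p q p' q'
    proof (rule ccontr)
      assume "\<not> (p = p' \<or> q = q')"
      then have "?S p \<le> ?S p' - s p'" "?T q' \<le> ?T q - t q"
        using cdf_less[OF P s that(1)] cdf_less[OF Q t that(2)] by auto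
      with overlap[OF that(3)] overlap[OF that(4)] show False by linarith
    qed
    show ?thesis
      using r r' crossing[of p p' q' q] crossing[of p' p q q'] w by (auto simp: prod_order_def)
  qed
  ultimately show ?thesis
    by (auto simp: chain_measures_def)
qed

section \<open>Coupling and marginals as mutually inverse maps\<close>

lemma marginals_coupling:
  assumes P: "finite P" "partial_order_on P r" and Q: "finite Q" "partial_order_on Q r'"
    and s: "s \<in> chain_measures P r" and t: "t \<in> chain_measures Q r'"
  shows "marginals P Q (coupling P r s Q r' t) = (s, t)"
  using sum_coupling[OF P Q s t] sum_coupling[OF Q P t s]
  by (simp add: marginals_def coupling_swap[of P r s Q r' t])

text \<open>A point charged by a marginal lies under a charged point of the product, and
  comparability in the product order descends to each coordinate.\<close>

lemma marginals_in_chain_measures: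
  assumes fin: "finite P" "finite Q" and w: "w \<in> chain_measures (P \<times> Q) (prod_order r r')"
  shows "marginals P Q w \<in> chain_measures P r \<times> chain_measures Q r'"
proof -
  note nn = chain_measuresD(1)[OF w] and z = chain_measuresD(2)[OF w]
  have one: "(\<Sum>p\<in>P. \<Sum>q\<in>Q. w (p, q)) = 1"
    using w by (simp add: chain_measures_def sum.cartesian_product')
  have chain: "((p, q), (p', q')) \<in> prod_order r r' \<or> ((p', q'), (p, q)) \<in> prod_order r r'"
    if "w (p, q) \<noteq> 0" "w (p', q') \<noteq> 0" for p q p' q'
    using chain_measuresD(4)[OF w that] .
  have "(\<lambda>p. \<Sum>q\<in>Q. w (p, q)) \<in> chain_measures P r"
  proof -
    have "(p, p') \<in> r \<or> (p', p) \<in> r"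
      if ne: "(\<Sum>q\<in>Q. w (p, q)) \<noteq> 0" "(\<Sum>q\<in>Q. w (p', q)) \<noteq> 0" for p p'
    proof -
      obtain q where 1: "w (p, q) \<noteq> 0"
        using ne(1) by (rule sum.not_neutral_contains_not_neutral)
      obtain q' where 2: "w (p', q') \<noteq> 0"
        using ne(2) by (rule sum.not_neutral_contains_not_neutral)
      from chain[OF 1 2] show ?thesis by (auto simp: prod_order_def)
    qed
    then show ?thesis
      using one by (simp add: chain_measures_def sum_nonneg nn z)
  qed
  moreover have "(\<lambda>q. \<Sum>p\<in>P. w (p, q)) \<in> chain_measures Q r'"
  proof -
    have "(q, q') \<in> r' \<or> (q', q) \<in> r'"
      if ne: "(\<Sum>p\<in>P. w (p, q)) \<noteq> 0" "(\<Sum>p\<in>P. w (p, q')) \<noteq> 0" for q q'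
    proof -
      obtain p where 1: "w (p, q) \<noteq> 0"
        using ne(1) by (rule sum.not_neutral_contains_not_neutral)
      obtain p' where 2: "w (p', q') \<noteq> 0"
        using ne(2) by (rule sum.not_neutral_contains_not_neutral)
      from chain[OF 1 2] show ?thesis by (auto simp: prod_order_def)
    qed
    then show ?thesis
      using one by (subst (asm) sum.swap) (simp add: chain_measures_def sum_nonneg nn z)
  qed
  ultimately show ?thesis by (simp add: marginals_def)
qed

text \<open>
  The preimages of down-sets of \<open>P\<close> and \<open>Q\<close> are down-sets of the support of \<open>w\<close>, hence nested since
  the support is a chain.
\<close>

lemma sum_down_sets:
  assumes fin: "finite P" "finite Q" and w: "w \<in> chain_measures (P \<times> Q) (prod_order r r')"
    and A: "A \<subseteq> P" "\<forall>y\<in>A. \<forall>x\<in>P. (x, y) \<in> r \<longrightarrow> x \<in> A"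
    and B: "B \<subseteq> Q" "\<forall>y\<in>B. \<forall>x\<in>Q. (x, y) \<in> r' \<longrightarrow> x \<in> B"
  shows "(\<Sum>z\<in>A \<times> B. w z) = min (\<Sum>p\<in>A. \<Sum>q\<in>Q. w (p, q)) (\<Sum>q\<in>B. \<Sum>p\<in>P. w (p, q))"
proof -
  note nn = chain_measuresD(1)[OF w] and z = chain_measuresD(2)[OF w]
  have chain: "((p, q), (p', q')) \<in> prod_order r r' \<or> ((p', q'), (p, q)) \<in> prod_order r r'"
    if "w (p, q) \<noteq> 0" "w (p', q') \<noteq> 0" for p q p' q'
    using chain_measuresD(4)[OF w that] .
  have finAB: "finite A" "finite B"
    using A(1) B(1) fin finite_subset by auto
  have AQ: "(\<Sum>p\<in>A. \<Sum>q\<in>Q. w (p, q)) = (\<Sum>z\<in>A \<times> Q. w z)"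
    by (simp add: sum.cartesian_product')
  have PB: "(\<Sum>q\<in>B. \<Sum>p\<in>P. w (p, q)) = (\<Sum>z\<in>P \<times> B. w z)"
    by (subst sum.swap) (simp add: sum.cartesian_product')
  have leA: "(\<Sum>z\<in>A \<times> B. w z) \<le> (\<Sum>z\<in>A \<times> Q. w z)"
    using finAB fin B(1) nn by (intro sum_mono2) auto
  have leB: "(\<Sum>z\<in>A \<times> B. w z) \<le> (\<Sum>z\<in>P \<times> B. w z)"
    using finAB fin A(1) nn by (intro sum_mono2) auto
  \<comment> \<open>Charged points violating both alternatives would be comparable: one direction
    puts \<open>q\<close> into \<open>B\<close>, the other puts \<open>p'\<close> into
    \<open>A\<close>.\<close>
  have "(\<forall>p\<in>A. \<forall>q\<in>Q - B. w (p, q) = 0) \<or> (\<forall>p\<in>P - A. \<forall>q\<in>B. w (p, q) = 0)"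
  proof (rule ccontr)
    assume "\<not> ?thesis"
    then obtain p q p' q' where "p \<in> A" "q \<in> Q - B" "w (p, q) \<noteq> 0" "p' \<in> P - A" "q' \<in> B" "w (p', q') \<noteq> 0"
      by blast
    with chain[of p q p' q'] A(2) B(2) show False
      by (auto simp: prod_order_def)
  qed
  then show ?thesis
  proof
    assume "\<forall>p\<in>A. \<forall>q\<in>Q - B. w (p, q) = 0"
    then have "(\<Sum>z\<in>A \<times> B. w z) = (\<Sum>z\<in>A \<times> Q. w z)"
      using finAB fin B(1) by (intro sum.mono_neutral_left) auto
    with leB show ?thesis by (simp add: AQ PB)
  next
    assume "\<forall>p\<in>P - A. \<forall>q\<in>B. w (p, q) = 0"
    then have "(\<Sum>z\<in>A \<times> B. w z) = (\<Sum>z\<in>P \<times> B. w z)"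
      using finAB fin A(1) by (intro sum.mono_neutral_left) auto
    with leA show ?thesis by (simp add: AQ PB)
  qed
qed

text \<open>By \<open>sum_down_sets\<close> each minimum in the coupling is the mass of a rectangle
  of down-sets, and inclusion-exclusion over the closed and strict down-sets of \<open>p\<close> and
  \<open>q\<close> leaves the single point \<open>(p, q)\<close>. Off \<open>P \<times> Q\<close>
  both functions vanish.\<close>

lemma coupling_marginals:
  fixes w :: "'p \<times> 'q \<Rightarrow> real"
  assumes P: "finite P" "partial_order_on P r" and Q: "finite Q" "partial_order_on Q r'"
    and w: "w \<in> chain_measures (P \<times> Q) (prod_order r r')"
  shows "coupling P r (fst (marginals P Q w)) Q r' (snd (marginals P Q w)) = w"
proof
  fix z :: "'p \<times> 'q"
  obtain p q where pq: "z = (p, q)" by (cases z)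
  let ?s = "fst (marginals P Q w)" and ?t = "snd (marginals P Q w)"
  have s: "?s \<in> chain_measures P r" and t: "?t \<in> chain_measures Q r'"
    using marginals_in_chain_measures[OF P(1) Q(1) w] by (auto simp: mem_Times_iff)
  show "coupling P r ?s Q r' ?t z = w z"
  proof (cases "z \<in> P \<times> Q")
    case False
    then have "w z = 0" "coupling P r ?s Q r' ?t z = 0"
      using chain_measuresD(2)[OF w] chain_measuresD(2)[OF coupling_in_chain_measures[OF P Q s t]] by auto
    then show ?thesis by simp
  next
    case True
    note po = partial_order_onD[OF P(2)] and qo = partial_order_onD[OF Q(2)]
    define A where "A = {x. x \<in> P \<and> (x, p) \<in> r}"
    define A' where "A' = {x. x \<in> P \<and> (x, p) \<in> r \<and> x \<noteq> p}"
    define B where "B = {y. y \<in> Q \<and> (y, q) \<in> r'}"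
    define B' where "B' = {y. y \<in> Q \<and> (y, q) \<in> r' \<and> y \<noteq> q}"
    have fin: "finite A'" "finite B'"
      using P(1) Q(1) by (auto simp: A'_def B'_def)
    have A: "A = insert p A'" "p \<notin> A'" and B: "B = insert q B'" "q \<notin> B'"
      using True po(1) qo(1) by (auto simp: A_def A'_def B_def B'_def refl_on_def pq)
    have sub: "A \<subseteq> P" "A' \<subseteq> P" "B \<subseteq> Q" "B' \<subseteq> Q"
      by (auto simp: A_def A'_def B_def B'_def)
    have downA: "\<forall>y\<in>A. \<forall>x\<in>P. (x, y) \<in> r \<longrightarrow> x \<in> A"
      using po(2) by (auto simp: A_def dest: transD)
    have downA': "\<forall>y\<in>A'. \<forall>x\<in>P. (x, y) \<in> r \<longrightarrow> x \<in> A'"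
      using po(2,3) by (auto simp: A'_def dest: transD antisymD)
    have downB: "\<forall>y\<in>B. \<forall>x\<in>Q. (x, y) \<in> r' \<longrightarrow> x \<in> B"
      using qo(2) by (auto simp: B_def dest: transD)
    have downB': "\<forall>y\<in>B'. \<forall>x\<in>Q. (x, y) \<in> r' \<longrightarrow> x \<in> B'"
      using qo(2,3) by (auto simp: B'_def dest: transD antisymD)
    note sums = sum_down_sets[OF P(1) Q(1) w]
    have S: "cdf P r ?s p = (\<Sum>x\<in>A. \<Sum>y\<in>Q. w (x, y))"
      by (simp add: cdf_def A_def marginals_def)
    have S': "cdf P r ?s p - ?s p = (\<Sum>x\<in>A'. \<Sum>y\<in>Q. w (x, y))"
      unfolding cdf_diff[OF P s] by (simp add: A'_def marginals_def)
    have T: "cdf Q r' ?t q = (\<Sum>y\<in>B. \<Sum>x\<in>P. w (x, y))"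
      by (simp add: cdf_def B_def marginals_def)
    have T': "cdf Q r' ?t q - ?t q = (\<Sum>y\<in>B'. \<Sum>x\<in>P. w (x, y))"
      unfolding cdf_diff[OF Q t] by (simp add: B'_def marginals_def)
    have "coupling P r ?s Q r' ?t z =
        (\<Sum>z\<in>A \<times> B. w z) - (\<Sum>z\<in>A' \<times> B. w z) - (\<Sum>z\<in>A \<times> B'. w z) + (\<Sum>z\<in>A' \<times> B'. w z)"
      unfolding coupling_def pq prod.case S' T' unfolding S T
      using sums[OF sub(1) downA sub(3) downB] sums[OF sub(2) downA' sub(3) downB]
        sums[OF sub(1) downA sub(4) downB'] sums[OF sub(2) downA' sub(4) downB']
      by simp
    also have "\<dots> = w z"
      unfolding sum.cartesian_product' A(1) B(1) pq
      using A(2) B(2) fin by (simp add: sum.distrib)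
    finally show ?thesis .
  qed
qed

lemma continuous_map_marginals:
  assumes "finite P" "finite Q"
  shows "continuous_map (chain_space (P \<times> Q) (prod_order r r'))
           (prod_topology (chain_space P r) (chain_space Q r')) (marginals P Q)"
proof -
  let ?X = "chain_space (P \<times> Q) (prod_order r r')"
  have proj: "continuous_map ?X euclideanreal (\<lambda>w. w z)" for z
    unfolding chain_space_def
    by (intro continuous_map_from_subtopology continuous_map_product_projection) auto
  have "continuous_map ?X (powertop_real UNIV) (\<lambda>w p. \<Sum>q\<in>Q. w (p, q))"
    "continuous_map ?X (powertop_real UNIV) (\<lambda>w q. \<Sum>p\<in>P. w (p, q))"
    unfolding continuous_map_componentwise_UNIV
    using assms proj by (auto intro!: continuous_map_sum)
  moreover have "(\<lambda>p. \<Sum>q\<in>Q. w (p, q)) \<in> chain_measures P r \<and> (\<lambda>q. \<Sum>p\<in>P. w (p, q)) \<in> chain_measures Q r'"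
    if "w \<in> topspace ?X" for w
    using marginals_in_chain_measures[OF assms, of w r r'] that by (simp add: marginals_def)
  ultimately show ?thesis
    unfolding continuous_map_pairwise chain_space_def[of P] chain_space_def[of Q]
    by (auto simp: o_def marginals_def continuous_map_in_subtopology)
qed

text \<open>Couplings invert the continuous marginal map, so compactness and the Hausdorff property
  suffice. Compactness is a hypothesis, to be inherited from a realization.\<close>

proposition chain_space_Times_homeomorphic:
  assumes P: "finite P" "partial_order_on P r" and Q: "finite Q" "partial_order_on Q r'"
    and cpt: "compact_space (chain_space (P \<times> Q) (prod_order r r'))"
  shows "chain_space (P \<times> Q) (prod_order r r') homeomorphic_space
         prod_topology (chain_space P r) (chain_space Q r')"
proof (rule homeomorphic_map_imp_homeomorphic_space, rule continuous_imp_homeomorphic_map)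
  let ?X = "chain_space (P \<times> Q) (prod_order r r')"
  let ?Y = "prod_topology (chain_space P r) (chain_space Q r')"
  show "compact_space ?X" by (rule cpt)
  show "Hausdorff_space ?Y"
    by (simp add: Hausdorff_space_prod_topology Hausdorff_space_chain_space)
  show "continuous_map ?X ?Y (marginals P Q)"
    by (rule continuous_map_marginals[OF P(1) Q(1)])
  show "marginals P Q ` topspace ?X = topspace ?Y"
  proof
    show "marginals P Q ` topspace ?X \<subseteq> topspace ?Y"
      using marginals_in_chain_measures[OF P(1) Q(1)] by (intro image_subsetI) simp
    show "topspace ?Y \<subseteq> marginals P Q ` topspace ?X"
    proof clarsimp
      fix s t assume st: "s \<in> chain_measures P r" "t \<in> chain_measures Q r'"
      show "(s, t) \<in> marginals P Q ` chain_measures (P \<times> Q) (prod_order r r')"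
        using marginals_coupling[OF P Q st] coupling_in_chain_measures[OF P Q st]
        by (metis image_eqI)
    qed
  qed
  show "inj_on (marginals P Q) (topspace ?X)"
    by (rule inj_onI) (metis coupling_marginals[OF P Q] topspace_chain_space)
qed


section \<open>The product of two posets\<close>

definition pair_simplex :: "nat \<Rightarrow> (nat \<Rightarrow> 'p) \<times> (nat \<Rightarrow> 'q) \<Rightarrow> nat \<Rightarrow> 'p \<times> 'q" where
  "pair_simplex k = (\<lambda>(f, g). \<lambda>i\<in>{..k}. (f i, g i))"

text \<open>A map is monotone for the product order exactly when both components are; the
  projections give the inverse.\<close>

lemma bij_betw_pair_simplex:
  "bij_betw (pair_simplex k) (simp_of (sset_prod (poset_sset P r) (poset_sset Q r')) k)
     (simp_of (poset_sset (P \<times> Q) (prod_order r r')) k)"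
proof (rule bij_betw_byWitness)
  let ?C = "simp_of (sset_prod (poset_sset P r) (poset_sset Q r')) k"
  let ?D = "simp_of (poset_sset (P \<times> Q) (prod_order r r')) k"
  let ?u = "\<lambda>h. (\<lambda>i\<in>{..k}. fst (h i), \<lambda>i\<in>{..k}. snd (h i))"
  show "\<forall>c\<in>?C. ?u (pair_simplex k c) = c"
    by (auto simp: sset_prod_def poset_sset_def pair_simplex_def fun_eq_iff PiE_iff extensional_def)
  show "\<forall>h\<in>?D. pair_simplex k (?u h) = h"
    by (auto simp: poset_sset_def pair_simplex_def fun_eq_iff PiE_iff extensional_def)
  show "pair_simplex k ` ?C \<subseteq> ?D"
    by (auto simp: sset_prod_def poset_sset_def pair_simplex_def prod_order_def monotone_on_def)
  show "?u ` ?D \<subseteq> ?C"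
  proof (rule image_subsetI)
    fix h assume h: "h \<in> ?D"
    have mem: "h i \<in> P \<times> Q" if "i \<le> k" for i
      using h that by (auto simp: poset_sset_def)
    have mono: "(h i, h j) \<in> prod_order r r'" if "i \<le> j" "j \<le> k" for i j
      using h that by (auto simp: poset_sset_def monotone_on_def)
    show "?u h \<in> ?C"
      using mem mono
      by (simp add: sset_prod_def poset_sset_def monotone_on_def prod_order_def case_prod_unfold mem_Times_iff)
  qed
qed

lemma pair_simplex_in_sset_hom:
  "(\<lambda>k. restrict (pair_simplex k) (simp_of (sset_prod (poset_sset P r) (poset_sset Q r')) k)) \<in>
     sset_hom (sset_prod (poset_sset P r) (poset_sset Q r')) (poset_sset (P \<times> Q) (prod_order r r'))"
  (is "?v \<in> sset_hom ?C ?D")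
proof -
  have "?v k \<in> simp_of ?C k \<rightarrow>\<^sub>E simp_of ?D k" for k
    using bij_betw_imp_surj_on[OF bij_betw_pair_simplex] by fastforce
  moreover have "?v k (act_of ?C k l \<theta> c) = act_of ?D k l \<theta> (?v l c)"
    if \<theta>: "\<theta> \<in> ord_maps k l" and c: "c \<in> simp_of ?C l" for k l \<theta> c
  proof -
    have "act_of ?C k l \<theta> c \<in> simp_of ?C k"
      using \<theta> c by (intro simplicial_set_act_in simplicial_set_sset_prod simplicial_set_poset_sset)
    moreover have "\<theta> i \<le> l" if "i \<le> k" for i
      using \<theta> that by (auto simp: ord_maps_def)
    then have "pair_simplex k (act_of ?C k l \<theta> c) = act_of ?D k l \<theta> (pair_simplex l c)"
      by (auto simp: pair_simplex_def sset_prod_def poset_sset_def compose_def fun_eq_iff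
          split: prod.splits)
    ultimately show ?thesis using c by simp
  qed
  ultimately show ?thesis by (simp add: sset_hom_def)
qed

section \<open>The homeomorphism of realizations\<close>

corollary geometric_realization_poset_sset:
  assumes "finite P" "partial_order_on P r"
  shows "geometric_realization (poset_sset P r) homeomorphic_space chain_space P r"
proof (rule geometric_realization_homeomorphic_chain_space(2)[OF simplicial_set_poset_sset _ _ assms])
  \<comment> \<open>The identity plays the role of the isomorphism, restricted because
    \<open>sset_hom\<close> asks for extensional components.\<close>
  let ?v = "\<lambda>k. restrict id (simp_of (poset_sset P r) k)"
  have "act_of (poset_sset P r) k l \<theta> x \<in> simp_of (poset_sset P r) k"
    if "\<theta> \<in> ord_maps k l" "x \<in> simp_of (poset_sset P r) l" for k l \<theta> x
    using that simplicial_set_act_in[OF simplicial_set_poset_sset] by metis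
  then show "?v \<in> sset_hom (poset_sset P r) (poset_sset P r)"
    by (simp add: sset_hom_def)
  show "bij_betw (?v k) (simp_of (poset_sset P r) k) (simp_of (poset_sset P r) k)" for k
    by (simp add: bij_betw_def inj_on_def)
qed

theorem proposition3p7:
  fixes P :: "'p set" and leP :: "'p rel"
    and Q :: "'q set" and leQ :: "'q rel"
  assumes "finite P" and "partial_order_on P leP"
    and "finite Q" and "partial_order_on Q leQ"
  shows "geometric_realization (sset_prod (poset_sset P leP) (poset_sset Q leQ))
           homeomorphic_space
         prod_topology (geometric_realization (poset_sset P leP))
                       (geometric_realization (poset_sset Q leQ))"
proof -
  let ?C = "sset_prod (poset_sset P leP) (poset_sset Q leQ)"
  let ?K = "chain_space (P \<times> Q) (prod_order leP leQ)"
  have C: "simplicial_set ?C"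
    by (intro simplicial_set_sset_prod simplicial_set_poset_sset)
  have bij: "bij_betw (restrict (pair_simplex k) (simp_of ?C k)) (simp_of ?C k)
      (simp_of (poset_sset (P \<times> Q) (prod_order leP leQ)) k)" for k
    using bij_betw_pair_simplex[of k P leP Q leQ] by (simp add: bij_betw_def)
  have fin: "finite (P \<times> Q)"
    using assms(1,3) by simp
  note realization = geometric_realization_homeomorphic_chain_space[OF C pair_simplex_in_sset_hom bij
      fin partial_order_on_prod_order[OF assms(2,4)]]
  \<comment> \<open>Compactness of the realization passes to \<open>?K\<close> along their
    homeomorphism, as needed to compare \<open>?K\<close> with the product.\<close>
  have "compact_space ?K"
    using realization homeomorphic_compact_space by blast
  then have "?K homeomorphic_space prod_topology (chain_space P leP) (chain_space Q leQ)"
    by (rule chain_space_Times_homeomorphic[OF assms])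
  moreover have "prod_topology (chain_space P leP) (chain_space Q leQ) homeomorphic_space
      prod_topology (geometric_realization (poset_sset P leP)) (geometric_realization (poset_sset Q leQ))"
    by (rule homeomorphic_space_prod_topology[OF
          geometric_realization_poset_sset[OF assms(1,2), THEN homeomorphic_space_sym[THEN iffD1]]
          geometric_realization_poset_sset[OF assms(3,4), THEN homeomorphic_space_sym[THEN iffD1]]])
  ultimately show ?thesis
    by (rule homeomorphic_space_trans[OF realization(2) homeomorphic_space_trans])
qed

end
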